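(* Let $s=(s_1,\dots,s_n)$ be a composition and $w,w'$ Stirling $s$-permutations. Then one of $w,w'$ covers the other in the $s$-weak order if and only if the simplices $\Delta_w$ and $\Delta_{w'}$ are adjacent (share a common facet) in the DKK triangulation of $\mathcal F_{G_s}$.
   Context: $s$ is a composition, $|s|=\sum s_i$. Stirling $s$-permutation: word with each $i\in[n]$ occurring $s_i$ times, avoiding $121$ (no $i<j$ with a $j$ between two $i$'s). For $a<c$ let $\#_w(c,a)$ be the number of occurrences of $c$ preceding the shortest consecutive substring containing all $a$'s. $s$-weak order: $w\le w'$ iff $\#_w(c,a)\le\#_{w'}(c,a)$ for all $1\le a<c\le n$. $w_{[i]}$ is the prefix of length $i$. Graph $G_s$ ($s_{n+1}:=2$): vertices $v_{-1},\dots,v_n$; source-edges $e^i_1,\dots,e^i_{s_i-1}$ from $v_{-1}$ to $v_{n+1-i}$ ($i\in[1,n+1]$); bump $e^i_0$ and dip $e^i_{s_i}$ from $v_{n-i}$ to $v_{n+1-i}$ ($i\in[1,n]$). Routes: directed paths $v_{-1}\to v_n$. $\mathcal F_{G_s}\subset\mathbb R^E$: nonnegative flows with netflow $1$ at $v_{-1}$, $-1$ at $v_n$, $0$ elsewhere; its vertices are indicator vectors of routes. Framing: incoming edges at $v_{n+1-i}$ ordered $e^i_0\prec e^i_1\prec\dots\prec e^i_{s_i}$, outgoing edges at $v_{n+1-i}$ ordered $e^{i-1}_0\prec e^{i-1}_{s_{i-1}}$. Two routes are coherent if at each maximal common subpath from inner vertex $v_i$ to inner vertex $v_j$, their initial parts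 up to $v_i$ and their final parts from $v_j$ are ordered the same way, where partial routes are compared by the framing order of their edges at the vertex where they last (resp. first) diverge. Simplices spanned by indicator vectors of sets of pairwise coherent routes form a triangulation of $\mathcal F_{G_s}$ (the DKK triangulation). For a prefix $u$: $t_a$ = number of $a$'s in $u$; $c$ = smallest $a\in[n]$ with $0<t_a<s_a$ (if none, $c=n+1$, $t_{n+1}=1$); $\mathrm{route}(u)=(e^c_{t_c},e^{c-1}_{t_{c-1}},\dots,e^1_{t_1})$. $\Delta_w$ is the simplex spanned by the routes $\mathrm{route}(w_{[i]})$, $0\le i\le |s|$. *)

theory Defs
  imports "HOL-Analysis.Analysis" "HOL-Analysis.Finite_Function_Topology"
begin

definition composition :: "nat list \<Rightarrow> bool" where
  "composition s \<longleftrightarrow> (\<forall>x \<in> set s. 0 < x)"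

text \<open>The parts are indexed from 1, with the additional convention \<open>s\<^sub>n\<^sub>+\<^sub>1 = 2\<close>.\<close>

definition part :: "nat list \<Rightarrow> nat \<Rightarrow> nat" where
  "part s i = (s @ [2]) ! (i - 1)"

definition avoids_121 :: "nat list \<Rightarrow> bool" where
  "avoids_121 w \<longleftrightarrow>
     \<not> (\<exists>p q r. p < q \<and> q < r \<and> r < length w \<and> w ! p = w ! r \<and> w ! p < w ! q)"

definition stirling_perm :: "nat list \<Rightarrow> nat list \<Rightarrow> bool" where
  "stirling_perm s w \<longleftrightarrow>
     set w \<subseteq> {1..length s} \<and> (\<forall>i \<in> {1..length s}. count_list w i = part s i) \<and> avoids_121 w"

text \<open>The shortest consecutive substring of \<open>w\<close> containing all the \<open>a\<close>'s starts at the first \<open>a\<close>,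
  so what precedes it is the longest prefix of \<open>w\<close> without an \<open>a\<close>.\<close>

definition num_before :: "nat list \<Rightarrow> nat \<Rightarrow> nat \<Rightarrow> nat" where
  "num_before w c a = count_list (takeWhile (\<lambda>x. x \<noteq> a) w) c"

definition weak_le :: "nat list \<Rightarrow> nat list \<Rightarrow> nat list \<Rightarrow> bool" where
  "weak_le s w w' \<longleftrightarrow>
     (\<forall>a c. 1 \<le> a \<and> a < c \<and> c \<le> length s \<longrightarrow> num_before w c a \<le> num_before w' c a)"

definition weak_less :: "nat list \<Rightarrow> nat list \<Rightarrow> nat list \<Rightarrow> bool" where
  "weak_less s w w' \<longleftrightarrow> weak_le s w w' \<and> w \<noteq> w'"

definition covered_by :: "nat list \<Rightarrow> nat list \<Rightarrow> nat list \<Rightarrow> bool" where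
  "covered_by s w w' \<longleftrightarrow>
     stirling_perm s w \<and> stirling_perm s w' \<and> weak_less s w w' \<and>
     \<not> (\<exists>z. stirling_perm s z \<and> weak_less s w z \<and> weak_less s z w')"


text \<open>The pair \<open>(i, k)\<close> stands for the edge \<open>e\<^sup>i\<^sub>k\<close> of the graph \<open>G\<^sub>s\<close>, and the integer \<open>j\<close> for its vertex
  \<open>v\<^sub>j\<close>, where \<open>- 1 \<le> j \<le> n\<close> for \<open>n = length s\<close>.\<close>

type_synonym edge = "nat \<times> nat"

definition source_edges :: "nat list \<Rightarrow> edge set" where
  "source_edges s = {(i, k). 1 \<le> i \<and> i \<le> length s + 1 \<and> 1 \<le> k \<and> k \<le> part s i - 1}"

definition bumps :: "nat list \<Rightarrow> edge set" where
  "bumps s = {(i, 0) | i. 1 \<le> i \<and> i \<le> length s}"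

definition dips :: "nat list \<Rightarrow> edge set" where
  "dips s = {(i, part s i) | i. 1 \<le> i \<and> i \<le> length s}"

definition edges :: "nat list \<Rightarrow> edge set" where
  "edges s = source_edges s \<union> bumps s \<union> dips s"

definition tail :: "nat list \<Rightarrow> edge \<Rightarrow> int" where
  "tail s e = (if e \<in> source_edges s then - 1 else int (length s) - int (fst e))"

definition head :: "nat list \<Rightarrow> edge \<Rightarrow> int" where
  "head s e = int (length s) + 1 - int (fst e)"

fun dipath :: "nat list \<Rightarrow> int \<Rightarrow> edge list \<Rightarrow> int \<Rightarrow> bool" where
  "dipath s u [] v \<longleftrightarrow> u = v"
| "dipath s u (e # p) v \<longleftrightarrow> e \<in> edges s \<and> tail s e = u \<and> dipath s (head s e) p v"

definition routes :: "nat list \<Rightarrow> edge list set" where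
  "routes s = {p. dipath s (- 1) p (int (length s))}"

text \<open>The space \<open>\<real>\<^sup>E\<close> is realised as the finitely supported functions vanishing off \<open>E = edges s\<close>.\<close>

definition netflow :: "nat list \<Rightarrow> (edge \<Rightarrow>\<^sub>0 real) \<Rightarrow> int \<Rightarrow> real" where
  "netflow s f v =
     (\<Sum>e \<in> {e \<in> edges s. tail s e = v}. Poly_Mapping.lookup f e) -
     (\<Sum>e \<in> {e \<in> edges s. head s e = v}. Poly_Mapping.lookup f e)"

definition flow_polytope :: "nat list \<Rightarrow> (edge \<Rightarrow>\<^sub>0 real) set" where
  "flow_polytope s =
     {f. Poly_Mapping.keys f \<subseteq> edges s \<and> (\<forall>e \<in> edges s. 0 \<le> Poly_Mapping.lookup f e) \<and>
         netflow s f (- 1) = 1 \<and> netflow s f (int (length s)) = - 1 \<and>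
         (\<forall>v \<in> {0..<int (length s)}. netflow s f v = 0)}"

definition route_vector :: "edge list \<Rightarrow> (edge \<Rightarrow>\<^sub>0 real)" where
  "route_vector p = (\<Sum>e \<in> set p. Poly_Mapping.single e 1)"


text \<open>The framing. All edges entering a given vertex have the same upper index; the two edges leaving
  an inner vertex are a bump and a dip with the same upper index.\<close>

definition in_less :: "edge \<Rightarrow> edge \<Rightarrow> bool" where
  "in_less e f \<longleftrightarrow> fst e = fst f \<and> snd e < snd f"

definition out_less :: "nat list \<Rightarrow> edge \<Rightarrow> edge \<Rightarrow> bool" where
  "out_less s e f \<longleftrightarrow> (\<exists>i \<in> {1..length s}. e = (i, 0) \<and> f = (i, part s i))"

text \<open>Partial routes ending at (resp. starting from) a common vertex.\<close>

definition initial_less :: "edge list \<Rightarrow> edge list \<Rightarrow> bool" where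
  "initial_less p q \<longleftrightarrow>
     (\<exists>p' q' e f r. p = p' @ e # r \<and> q = q' @ f # r \<and> e \<noteq> f \<and> in_less e f)"

definition final_less :: "nat list \<Rightarrow> edge list \<Rightarrow> edge list \<Rightarrow> bool" where
  "final_less s p q \<longleftrightarrow>
     (\<exists>p' q' e f r. p = r @ e # p' \<and> q = r @ f # q' \<and> e \<noteq> f \<and> out_less s e f)"

text \<open>Here \<open>m\<close> is a common subpath (possibly a single vertex) of \<open>P\<close> and \<open>Q\<close> from the inner vertex \<open>u\<close>
  to the inner vertex \<open>v\<close>; it is maximal when it can be prolonged on neither side.\<close>

definition coherent :: "nat list \<Rightarrow> edge list \<Rightarrow> edge list \<Rightarrow> bool" where
  "coherent s P Q \<longleftrightarrow>
     (\<forall>p1 q1 m p2 q2. \<forall>u \<in> {0..<int (length s)}. \<forall>v \<in> {0..<int (length s)}.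
        P = p1 @ m @ p2 \<and> Q = q1 @ m @ q2 \<and>
        dipath s (- 1) p1 u \<and> dipath s (- 1) q1 u \<and> dipath s u m v \<and>
        dipath s v p2 (int (length s)) \<and> dipath s v q2 (int (length s)) \<and>
        last p1 \<noteq> last q1 \<and> hd p2 \<noteq> hd q2
        \<longrightarrow> (initial_less p1 q1 \<longleftrightarrow> final_less s p2 q2))"

definition dkk_triangulation :: "nat list \<Rightarrow> (edge \<Rightarrow>\<^sub>0 real) set set" where
  "dkk_triangulation s =
     {convex hull (route_vector ` K) | K. K \<noteq> {} \<and> K \<subseteq> routes s \<and> pairwise (coherent s) K}"

text \<open>The library notion of facet is restricted to Euclidean spaces; for a simplex, the facets are
  the faces opposite to its vertices.\<close>

definition simplex_facet :: "'a::real_vector set \<Rightarrow> 'a set \<Rightarrow> bool" where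
  "simplex_facet F S \<longleftrightarrow>
     (\<exists>C a. finite C \<and> \<not> affine_dependent C \<and> S = convex hull C \<and>
            a \<in> C \<and> F = convex hull (C - {a}))"

text \<open>Adjacency of maximal simplices in a triangulation \<open>\<T>\<close> of the polytope \<open>P\<close>; maximality is
  expressed by full dimension in \<open>P\<close>, that is, by having the same affine hull as \<open>P\<close>.\<close>

definition adjacent_in :: "'a::real_vector set \<Rightarrow> 'a set set \<Rightarrow> 'a set \<Rightarrow> 'a set \<Rightarrow> bool" where
  "adjacent_in P \<T> S T \<longleftrightarrow>
     S \<in> \<T> \<and> T \<in> \<T> \<and> affine hull S = affine hull P \<and> affine hull T = affine hull P \<and>
     S \<noteq> T \<and> (\<exists>F. simplex_facet F S \<and> simplex_facet F T)"


definition route_start :: "nat list \<Rightarrow> nat list \<Rightarrow> nat" where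
  "route_start s u =
     (let A = {a \<in> {1..length s}. 0 < count_list u a \<and> count_list u a < part s a}
      in if A = {} then length s + 1 else Min A)"

definition route :: "nat list \<Rightarrow> nat list \<Rightarrow> edge list" where
  "route s u =
     map (\<lambda>a. (a, if a = length s + 1 then 1 else count_list u a)) (rev [1..<route_start s u + 1])"

definition Delta :: "nat list \<Rightarrow> nat list \<Rightarrow> (edge \<Rightarrow>\<^sub>0 real) set" where
  "Delta s w = convex hull ((\<lambda>i. route_vector (route s (take i w))) ` {0..sum_list s})"

end

theory Submission
  imports Defs
begin

text \<open>Both sides amount to a single ascent move \<open>u B c v \<mapsto> u c B v\<close>, where \<open>B\<close> is the shortest
  substring containing all the \<open>a\<close>'s and \<open>a < c\<close>.

  Such a move raises exactly the numbers \<open>#(c, z)\<close> with \<open>z\<close> in \<open>B\<close> by one. If \<open>w < w'\<close>, let \<open>y\<close> be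
  the letter of \<open>w'\<close> after the longest common prefix of \<open>w\<close> and \<open>w'\<close>; moving the next \<open>y\<close> of \<open>w\<close>
  in front of the block preceding it stays below \<open>w'\<close>. Hence the covers are the ascent moves.

  Reading the \<open>t\<close>-th letter \<open>a\<close> of \<open>w\<close> brings the edge \<open>(a, t)\<close> into the route of the prefix for the
  first time. So the routes of the prefixes form a triangular family, whose members are linearly
  independent and span all flows: \<open>\<Delta>\<^sub>w\<close> is a full-dimensional simplex, and two such simplices share a
  facet iff their sets of routes differ in one element. An ascent move replaces only the route of
  \<open>u B\<close> by that of \<open>u c\<close>. Conversely, if \<open>w\<close> and \<open>w'\<close> continue their common prefix \<open>u\<close> with \<open>x < y\<close>,
  the route of \<open>u y\<close> is missing from \<open>w\<close> and every prefix of \<open>w\<close> that has read \<open>x\<close>, has not read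
  another \<open>y\<close> and has no open letter below \<open>y\<close> gives a route missing from \<open>w'\<close>; if there is only one
  such prefix, then \<open>w\<close> continues after \<open>u\<close> with the block of \<open>x\<close> followed by \<open>y\<close>.\<close>

subsection \<open>Stirling permutations\<close>

lemma avoids_121_iff:
  "avoids_121 w \<longleftrightarrow> (\<forall>p y r x. w = p @ y # r \<longrightarrow> x \<in> set p \<longrightarrow> x \<in> set r \<longrightarrow> y \<le> x)"
proof
  assume w: "avoids_121 w"
  show "\<forall>p y r x. w = p @ y # r \<longrightarrow> x \<in> set p \<longrightarrow> x \<in> set r \<longrightarrow> y \<le> x"
  proof (intro allI impI, rule ccontr)
    fix p y r x assume *: "w = p @ y # r" "x \<in> set p" "x \<in> set r" "\<not> y \<le> x"
    obtain i where i: "i < length p" "p ! i = x" using *(2) by (auto simp: in_set_conv_nth)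
    obtain j where j: "j < length r" "r ! j = x" using *(3) by (auto simp: in_set_conv_nth)
    have "w ! i = x" "w ! length p = y" "w ! (Suc (length p) + j) = x"
      using *(1) i j by (auto simp: nth_append)
    moreover have "Suc (length p) + j < length w" using *(1) j by simp
    ultimately show False using w i(1) *(4) unfolding avoids_121_def
      by (metis add_Suc less_add_Suc1 not_le)
  qed
next
  assume *: "\<forall>p y r x. w = p @ y # r \<longrightarrow> x \<in> set p \<longrightarrow> x \<in> set r \<longrightarrow> y \<le> x"
  show "avoids_121 w" unfolding avoids_121_def
  proof (intro notI, elim exE conjE)
    fix p q r assume h: "p < q" "q < r" "r < length w" "w ! p = w ! r" "w ! p < w ! q"
    have "w = take q w @ w ! q # drop (Suc q) w" using h by (simp add: id_take_nth_drop)
    moreover have "w ! p \<in> set (take q w)" using h by (auto simp: in_set_conv_nth)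
    moreover have "w ! r \<in> set (drop (Suc q) w)"
      using h by (auto simp: in_set_conv_nth intro!: exI[of _ "r - Suc q"])
    ultimately show False using * h by (metis not_le)
  qed
qed

lemma stirling_perm_121:
  assumes "stirling_perm s w" "w = p @ y # r" "x \<in> set p" "x \<in> set r"
  shows "y \<le> x"
  using assms avoids_121_iff unfolding stirling_perm_def by blast

lemma count_list_stirling_perm_eq:
  assumes "stirling_perm s w" "stirling_perm s w'"
  shows "count_list w x = count_list w' x"
proof (cases "x \<in> {1..length s}")
  case True
  then show ?thesis using assms by (simp add: stirling_perm_def)
next
  case False
  then have "x \<notin> set w" "x \<notin> set w'" using assms unfolding stirling_perm_def by auto
  then show ?thesis by simp
qed

lemma part_eq_nth: "1 \<le> i \<Longrightarrow> i \<le> length s \<Longrightarrow> part s i = s ! (i - 1)"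
  by (cases i) (auto simp: part_def nth_append)

lemma part_pos: "composition s \<Longrightarrow> 1 \<le> i \<Longrightarrow> i \<le> length s \<Longrightarrow> 0 < part s i"
  by (simp add: part_eq_nth composition_def)

lemma part_Suc_length [simp]: "part s (Suc (length s)) = 2"
  by (simp add: part_def nth_append)

lemma length_stirling_perm:
  assumes "stirling_perm s w"
  shows "length w = sum_list s"
proof -
  have "length w = (\<Sum>a\<in>{1..length s}. count_list w a)"
    using assms sum_count_set[of w "{1..length s}"] by (simp only: stirling_perm_def) simp
  also have "\<dots> = (\<Sum>a\<in>{1..length s}. s ! (a - 1))"
    using assms by (intro sum.cong) (auto simp: stirling_perm_def part_eq_nth)
  also have "\<dots> = (\<Sum>a\<in>{0..<length s}. s ! a)"
    by (rule sum.reindex_bij_witness[of _ Suc "\<lambda>a. a - 1"]) auto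
  finally show ?thesis by (simp add: sum_list_sum_nth)
qed

lemma count_list_pos_iff: "0 < count_list xs x \<longleftrightarrow> x \<in> set xs"
  using count_list_0_iff[of xs x] by auto

lemma stirling_perm_diverge:
  assumes "stirling_perm s w" "stirling_perm s w'" "w \<noteq> w'"
  obtains u x v y v' where "x \<noteq> y" "w = u @ x # v" "w' = u @ y # v'"
proof -
  have "length w = length w'" using assms length_stirling_perm by metis
  from same_length_different[OF assms(3) this] show ?thesis using that by auto
qed

lemma remaining_letter:
  assumes "stirling_perm s w" "stirling_perm s w'" "w = u @ v" "w' = u @ v'"
  shows "count_list v x = count_list v' x" "x \<in> set v \<longleftrightarrow> x \<in> set v'"
proof -
  show *: "count_list v x = count_list v' x" for x
    using count_list_stirling_perm_eq[OF assms(1,2), of x] assms(3,4) by simp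
  show "x \<in> set v \<longleftrightarrow> x \<in> set v'" using * count_list_0_iff by metis
qed

text \<open>Behind the common prefix both words have the same letters left, so \<open>x\<close> also
  occurs in \<open>v'\<close>. An \<open>x\<close> in \<open>u\<close> would then enclose the larger
  \<open>y\<close> in \<open>w'\<close>.\<close>

lemma smaller_letter_new:
  assumes "stirling_perm s w" "stirling_perm s w'" "w = u @ v" "w' = u @ y # v'" "x \<in> set v" "x < y"
  shows "x \<notin> set u"
proof
  assume "x \<in> set u"
  moreover have "x \<in> set (y # v')" using remaining_letter[OF assms(1-4)] assms(5) by blast
  then have "x \<in> set v'" using assms(6) by auto
  ultimately show False using stirling_perm_121[OF assms(2,4)] assms(6) by fastforce
qed

subsection \<open>Ascent moves\<close>

text \<open>The conditions make \<open>B\<close> the shortest consecutive substring of \<open>w\<close> containing all the \<open>a\<close>'s.\<close>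

definition ascent_split :: "nat list \<Rightarrow> nat list \<Rightarrow> nat list \<Rightarrow> nat \<Rightarrow> nat \<Rightarrow> nat list \<Rightarrow> bool" where
  "ascent_split w u B a c v \<longleftrightarrow>
     w = u @ B @ c # v \<and> B \<noteq> [] \<and> hd B = a \<and> last B = a \<and> a < c \<and> a \<notin> set u \<and> a \<notin> set v"

definition ascent_move :: "nat list \<Rightarrow> nat list \<Rightarrow> bool" where
  "ascent_move w w' \<longleftrightarrow> (\<exists>u B a c v. ascent_split w u B a c v \<and> w' = u @ c # B @ v)"

text \<open>A letter \<open>z \<noteq> a\<close> of \<open>B\<close> lies between two
  \<open>a\<close>'s, hence \<open>z < a\<close>. A further \<open>z\<close> outside
  \<open>B\<close> would enclose the first or the last \<open>a\<close> of \<open>B\<close>.\<close>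

lemma ascent_split_block:
  assumes "stirling_perm s w" "ascent_split w u B a c v" "z \<in> set B"
  shows "z \<le> a" "z \<notin> set u" "z \<notin> set v"
proof -
  note d = assms(2)[unfolded ascent_split_def]
  obtain B1 where B1: "B = a # B1" using d by (cases B) auto
  obtain B2 where B2: "B = B2 @ [a]" using d by (metis append_butlast_last_id)
  show za: "z \<le> a"
  proof (cases "z = a")
    case False
    then have "z \<in> set B1" using assms(3) B1 by simp
    then obtain b1 b2 where b: "B1 = b1 @ z # b2" by (meson split_list)
    have "a \<in> set b2"
      using B1 B2 b False by (metis append_Cons last.simps last_appendR last_in_set last_snoc list.distinct(1))
    then show ?thesis using stirling_perm_121[OF assms(1), of "u @ a # b1" z "b2 @ c # v" a] d B1 b by simp
  qed simp
  show "z \<notin> set u"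
  proof
    assume z: "z \<in> set u"
    then have "z \<noteq> a" using d by auto
    moreover have "z \<in> set B1" using assms(3) B1 calculation by simp
    ultimately show False
      using stirling_perm_121[OF assms(1), of "u" a "B1 @ c # v" z] d B1 z za by simp
  qed
  show "z \<notin> set v"
  proof
    assume z: "z \<in> set v"
    then have "z \<noteq> a" using d by auto
    moreover have "z \<in> set B2" using assms(3) B2 calculation by simp
    ultimately show False
      using stirling_perm_121[OF assms(1), of "u @ B2" a "c # v" z] d B2 z za by simp
  qed
qed

text \<open>Only \<open>c\<close> and the letters of \<open>B\<close> change their relative order.
  The letters of \<open>B\<close> are below \<open>c\<close> and occur nowhere else, so no pattern
  121 arises.\<close>

lemma ascent_move_stirling_perm:
  assumes "stirling_perm s w" "ascent_move w w'"
  shows "stirling_perm s w'"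
proof -
  obtain u B a c v where d: "ascent_split w u B a c v" and w': "w' = u @ c # B @ v"
    using assms(2) unfolding ascent_move_def by blast
  have w: "w = u @ B @ c # v" and ac: "a < c" using d by (auto simp: ascent_split_def)
  note blk = ascent_split_block[OF assms(1) d]
  note av = stirling_perm_121[OF assms(1)]
  have "avoids_121 w'" unfolding avoids_121_iff
  proof (intro allI impI)
    fix p y r x assume h: "w' = p @ y # r" "x \<in> set p" "x \<in> set r"
    have "u @ c # B @ v = p @ y # r" using h w' by simp
    then consider (1) r' where "u = p @ y # r'" "r = r' @ c # B @ v" | (2) "p = u" "y = c" "r = B @ v"
      | (3) b1 b2 where "B = b1 @ y # b2" "p = u @ c # b1" "r = b2 @ v"
      | (4) v1 where "v = v1 @ y # r" "p = u @ c # B @ v1"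
      by (fastforce simp: append_eq_append_conv2 Cons_eq_append_conv append_eq_Cons_conv)
    then show "y \<le> x"
    proof cases
      case 1
      then show ?thesis using av[of p y "r' @ B @ c # v" x] w h by auto
    next
      case 2
      then show ?thesis using av[of "u @ B" c v x] w h blk by auto
    next
      case 3
      have "y < c" using blk(1)[of y] 3 ac by simp
      then show ?thesis using av[of "u @ b1" y "b2 @ c # v" x] w h 3 by auto
    next
      case 4
      then show ?thesis using av[of "u @ B @ c # v1" y r x] w h by auto
    qed
  qed
  then show ?thesis using assms(1) w w' unfolding stirling_perm_def by (auto simp: ac_simps)
qed

section \<open>The weak order along ascent moves\<close>

lemma num_before_append:
  "num_before (u @ v) c a = (if a \<in> set u then num_before u c a else count_list u c + num_before v c a)"
proof (cases "a \<in> set u")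
  case True
  then show ?thesis by (simp add: num_before_def takeWhile_append1)
next
  case False
  then have "takeWhile (\<lambda>x. x \<noteq> a) (u @ v) = u @ takeWhile (\<lambda>x. x \<noteq> a) v"
    by (intro takeWhile_append2) auto
  then show ?thesis using False by (simp add: num_before_def)
qed

lemma num_before_Cons:
  "num_before (x # v) c a = (if x = a then 0 else (if x = c then 1 else 0) + num_before v c a)"
proof (cases "x = a")
  case True
  then show ?thesis by (simp add: num_before_def)
next
  case False
  then have "takeWhile (\<lambda>x. x \<noteq> a) (x # v) = x # takeWhile (\<lambda>x. x \<noteq> a) v" by simp
  with False show ?thesis unfolding num_before_def by simp
qed

text \<open>The moved \<open>c\<close> jumps over \<open>B\<close> alone, so the first
  \<open>z\<close> has one more \<open>c\<close> before it exactly when it lies in \<open>B\<close>.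
  For \<open>z = c\<close> nothing changes, since \<open>B\<close> has no letter above
  \<open>c\<close>.\<close>

lemma num_before_ascent_move:
  assumes "stirling_perm s w" "ascent_split w u B a c v" "z < d"
  shows "num_before (u @ c # B @ v) d z = num_before w d z + (if d = c \<and> z \<in> set B then 1 else 0)"
proof -
  have w: "w = u @ B @ c # v" and ac: "a < c" using assms(2) by (auto simp: ascent_split_def)
  note blk = ascent_split_block[OF assms(1,2)]
  have 1: "z \<noteq> c" if "z \<in> set B" using blk(1)[OF that] ac by simp
  have 2: "count_list B d = 0" if "z = c"
    using that assms(3) blk(1)[of d] ac by (intro count_notin) auto
  show ?thesis using 1 2 blk(2) assms(3) unfolding w by (auto simp: num_before_append num_before_Cons)
qed

lemma ascent_split_bounds:
  assumes "stirling_perm s w" "ascent_split w u B a c v"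
  shows "1 \<le> a" "a < c" "c \<le> length s" "a \<in> set B" "\<And>z. z \<in> set B \<Longrightarrow> 1 \<le> z \<and> z < c"
proof -
  have s: "set w \<subseteq> {1..length s}" using assms(1) by (simp add: stirling_perm_def)
  note d = assms(2)[unfolded ascent_split_def]
  show "a < c" "a \<in> set B" using d hd_in_set by auto
  then show "1 \<le> a" "c \<le> length s" using d s by auto
  show "\<And>z. z \<in> set B \<Longrightarrow> 1 \<le> z \<and> z < c"
    using ascent_split_block(1)[OF assms] d s by fastforce
qed

lemma ascent_move_weak_less:
  assumes "stirling_perm s w" "ascent_move w w'"
  shows "weak_less s w w'"
proof -
  obtain u B a c v where d: "ascent_split w u B a c v" and w': "w' = u @ c # B @ v"
    using assms(2) unfolding ascent_move_def by blast
  note n = num_before_ascent_move[OF assms(1) d]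
  have "num_before w' c a = num_before w c a + 1"
    using n[of a c] ascent_split_bounds[OF assms(1) d] w' by simp
  then have "w \<noteq> w'" by auto
  then show ?thesis using n unfolding weak_less_def weak_le_def w' by auto
qed

text \<open>Bringing the next \<open>y\<close> of \<open>w\<close> one block closer to its place in
  \<open>w'\<close> raises only numbers \<open>#(y, e)\<close> that are still smaller in
  \<open>w\<close> than in \<open>w'\<close>.\<close>

lemma ascent_move_below:
  assumes w: "stirling_perm s w" and w': "stirling_perm s w'" and le: "weak_le s w w'" and ne: "w \<noteq> w'"
  obtains z where "ascent_move w z" "weak_le s z w'"
proof -
  obtain u x v y v' where d: "x \<noteq> y" "w = u @ x # v" "w' = u @ y # v'"
    using stirling_perm_diverge[OF w w' ne] .
  have "y \<in> set (x # v)" using remaining_letter(2)[OF w w' d(2,3), of y] by simp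
  then obtain q r where q: "x # v = q @ y # r" "y \<notin> set q" by (meson split_list_first)
  have qne: "q \<noteq> []" using q d(1) by (cases q) auto
  have wq: "w = u @ q @ y # r" using d q by simp
  have sub: "set w \<subseteq> {1..length s}" using w by (simp add: stirling_perm_def)
  \<comment> \<open>A larger \<open>z\<close> in front of this \<open>y\<close> would lie between
    two \<open>y\<close>'s if \<open>u\<close> contains one; otherwise \<open>#(z, y)\<close> would
    be larger in \<open>w\<close> than in \<open>w'\<close>.\<close>
  have small: "z < y" if z: "z \<in> set q" for z
  proof (rule ccontr)
    assume "\<not> z < y"
    then have zy: "y < z" using z q(2) by (metis linorder_neqE_nat)
    show False
    proof (cases "y \<in> set u")
      case True
      obtain q1 q2 where "q = q1 @ z # q2" using z by (meson split_list)
      then show ?thesis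
        using stirling_perm_121[OF w, of "u @ q1" z "q2 @ y # r" y] wq True zy by simp
    next
      case False
      have "num_before w z y \<le> num_before w' z y"
        using le zy sub wq z unfolding weak_le_def by auto
      moreover have "num_before w' z y = count_list u z"
        using False d by (simp add: num_before_append num_before_Cons)
      moreover have "num_before w z y = count_list u z + count_list q z"
        using False wq q(2) by (simp add: num_before_append num_before_Cons)
      moreover have "0 < count_list q z" using z by (simp add: count_list_pos_iff)
      ultimately show False by simp
    qed
  qed
  have new: "z \<notin> set u" if "z \<in> set q" for z
    using smaller_letter_new[OF w w' wq d(3)] small that by auto
  \<comment> \<open>This is the letter directly before the chosen \<open>y\<close>; its block starts
    at its first occurrence in \<open>q\<close>, and 121-avoidance keeps it out of
    \<open>r\<close>.\<close>
  define a where "a = last q"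
  have aq: "a \<in> set q" using qne a_def by simp
  obtain q1 q2 where q12: "q = q1 @ a # q2" "a \<notin> set q1" using split_list_first[OF aq] by blast
  have ar: "a \<notin> set r"
    using stirling_perm_121[OF w, of "u @ q" y r a] wq aq small[OF aq] by auto
  have sp: "ascent_split w (u @ q1) (a # q2) a y r"
  proof -
    have "last (q1 @ a # q2) = a" using a_def q12(1) by metis
    then have l: "last (a # q2) = a" by simp
    have "w = (u @ q1) @ (a # q2) @ y # r" using wq q12(1) by (metis append.assoc)
    then show ?thesis
      unfolding ascent_split_def using l q12(2) small[OF aq] new[OF aq] ar by simp
  qed
  define z where "z = (u @ q1) @ y # (a # q2) @ r"
  have "ascent_move w z" unfolding ascent_move_def z_def using sp by blast
  moreover have "weak_le s z w'" unfolding weak_le_def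
  proof (intro allI impI)
    fix e d' assume h: "1 \<le> e \<and> e < d' \<and> d' \<le> length s"
    have eq: "num_before z d' e = num_before w d' e + (if d' = y \<and> e \<in> set (a # q2) then 1 else 0)"
      unfolding z_def using num_before_ascent_move[OF w sp] h by blast
    show "num_before z d' e \<le> num_before w' d' e"
    proof (cases "d' = y \<and> e \<in> set (a # q2)")
      case True
      then have eq': "e \<in> set q" using q12 by auto
      then have eu: "e \<notin> set u" "e \<noteq> y" using new q(2) by auto
      \<comment> \<open>Up to the first \<open>e\<close>, the word \<open>w\<close> reads only the
        \<open>y\<close>'s of \<open>u\<close>, whereas \<open>w'\<close> reads one more right after
        \<open>u\<close>.\<close>
      have "num_before q y e = 0"
        using q(2) set_takeWhileD unfolding num_before_def by (metis count_notin)
      then have "num_before w y e = count_list u y"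
        using eu eq' wq by (simp add: num_before_append)
      moreover have "num_before w' y e \<ge> count_list u y + 1"
        using eu d(3) by (simp add: num_before_append num_before_Cons)
      ultimately show ?thesis using eq True by simp
    next
      case False
      then show ?thesis using eq h le unfolding weak_le_def by auto
    qed
  qed
  ultimately show ?thesis using that by blast
qed

text \<open>Otherwise some ascent move from \<open>w\<close> stays below \<open>w'\<close> and
  strictly raises a number, against \<open>weak_le s w' w\<close>.\<close>

lemma weak_le_antisym:
  assumes "stirling_perm s w" "stirling_perm s w'" "weak_le s w w'" "weak_le s w' w"
  shows "w = w'"
proof (rule ccontr)
  assume "w \<noteq> w'"
  then obtain z where z: "ascent_move w z" "weak_le s z w'" using ascent_move_below assms by metis
  obtain u B a c v where d: "ascent_split w u B a c v" and z': "z = u @ c # B @ v"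
    using z(1) unfolding ascent_move_def by blast
  note b = ascent_split_bounds[OF assms(1) d]
  have "num_before z c a = num_before w c a + 1"
    using num_before_ascent_move[OF assms(1) d b(2)] b(4) z' by simp
  moreover have "num_before z c a \<le> num_before w' c a" "num_before w' c a \<le> num_before w c a"
    using z(2) assms(4) b unfolding weak_le_def by auto
  ultimately show False by simp
qed

section \<open>Covers are single ascent moves\<close>

lemma first_occurrence_eq:
  assumes "xs @ a # ys = xs' @ a # ys'" "a \<notin> set xs" "a \<notin> set xs'"
  shows "xs = xs' \<and> ys = ys'"
  using assms
proof (induction xs arbitrary: xs')
  case Nil
  then show ?case by (cases xs') auto
next
  case (Cons x xs)
  then show ?case by (cases xs') auto
qed

lemma last_occurrence_eq:
  assumes "xs @ a # ys = xs' @ a # ys'" "a \<notin> set ys" "a \<notin> set ys'"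
  shows "xs = xs' \<and> ys = ys'"
proof -
  have "rev ys @ a # rev xs = rev ys' @ a # rev xs'"
    using arg_cong[OF assms(1), of rev] by simp
  from first_occurrence_eq[OF this] show ?thesis using assms(2,3) by simp
qed

text \<open>In \<open>w\<close> the last \<open>a'\<close> is directly followed by \<open>c\<close>.
  Lying in \<open>B\<close>, it must be the end of \<open>B\<close>, because no letter of
  \<open>B\<close> exceeds \<open>a < c\<close>. So \<open>a' = a\<close> and the two blocks
  coincide.\<close>

lemma ascent_split_nested:
  assumes w: "stirling_perm s w"
    and d: "ascent_split w u B a c v" and d': "ascent_split w u' B' a' c v'" and a': "a' \<in> set B"
  shows "u = u' \<and> B = B' \<and> v = v'"
proof -
  note D = d[unfolded ascent_split_def] and D' = d'[unfolded ascent_split_def]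
  note blk = ascent_split_block[OF w d]
  obtain C' where C': "B' = C' @ [a']" using D' by (metis append_butlast_last_id)
  obtain b1 b2 where b: "B = b1 @ a' # b2" "a' \<notin> set b2" using split_list_last[OF a'] by blast
  have "(u @ b1) @ a' # (b2 @ c # v) = (u' @ C') @ a' # (c # v')"
    using D D' C' b by simp
  moreover have "a' \<notin> set (b2 @ c # v)" "a' \<notin> set (c # v')"
    using b blk(1,3)[OF a'] D D' by auto
  ultimately have e: "u @ b1 = u' @ C'" "b2 @ c # v = c # v'"
    using last_occurrence_eq[of "u @ b1" a' "b2 @ c # v" "u' @ C'" "c # v'"] by simp_all
  have "b2 = []"
  proof (rule ccontr)
    assume "b2 \<noteq> []"
    then obtain b3 where "b2 = c # b3" using e(2) by (cases b2) auto
    then show False using blk(1)[of c] b D by simp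
  qed
  then have aa: "a' = a" and vv: "v = v'" and BB: "B = b1 @ [a]" using b D e(2) by auto
  have ub: "u @ B = u' @ B'" using e(1) C' BB aa by simp
  obtain B1 B1' where "B = a # B1" "B' = a # B1'" using D D' aa by (metis list.collapse)
  then have "u = u' \<and> B = B'" using ub first_occurrence_eq[of u a B1 u' B1'] D D' aa by auto
  then show ?thesis using vv by simp
qed

lemma covered_by_iff_ascent_move:
  assumes w: "stirling_perm s w" and w': "stirling_perm s w'"
  shows "covered_by s w w' \<longleftrightarrow> ascent_move w w'"
proof
  assume c: "covered_by s w w'"
  then have "weak_le s w w'" "w \<noteq> w'" by (auto simp: covered_by_def weak_less_def)
  then obtain z where z: "ascent_move w z" "weak_le s z w'" using ascent_move_below[OF w w'] by blast
  have "z = w'"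
    using c z ascent_move_stirling_perm[OF w z(1)] ascent_move_weak_less[OF w z(1)]
    unfolding covered_by_def weak_less_def by blast
  then show "ascent_move w w'" using z by simp
next
  assume m: "ascent_move w w'"
  obtain u B a c v where d: "ascent_split w u B a c v" and w'_eq: "w' = u @ c # B @ v"
    using m unfolding ascent_move_def by blast
  \<comment> \<open>A \<open>z\<close> strictly in between lies above some ascent move
    \<open>y\<close> of \<open>w\<close>. The number raised by \<open>y\<close> is also raised by
    the given move, which forces \<open>y = w'\<close>.\<close>
  have False if z: "stirling_perm s z" "weak_less s w z" "weak_less s z w'" for z
  proof -
    have "weak_le s w z" "w \<noteq> z" using z(2) by (auto simp: weak_less_def)
    then obtain y where y: "ascent_move w y" "weak_le s y z" using ascent_move_below[OF w z(1)] by blast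
    obtain u' B' a' c' v' where d': "ascent_split w u' B' a' c' v'" and y_eq: "y = u' @ c' # B' @ v'"
      using y(1) unfolding ascent_move_def by blast
    note b' = ascent_split_bounds[OF w d']
    have "num_before y c' a' = num_before w c' a' + 1"
      using num_before_ascent_move[OF w d' b'(2)] b'(4) y_eq by simp
    moreover have "num_before y c' a' \<le> num_before z c' a'" "num_before z c' a' \<le> num_before w' c' a'"
      using y(2) z(3) b' unfolding weak_less_def weak_le_def by auto
    ultimately have "num_before w c' a' < num_before w' c' a'" by simp
    then have c: "c' = c" "a' \<in> set B"
      using num_before_ascent_move[OF w d b'(2)] w'_eq by (auto split: if_splits)
    then have "y = w'" using ascent_split_nested[OF w d _ c(2)] d' y_eq w'_eq by simp
    then have "z = w'" using weak_le_antisym[OF z(1) w'] y(2) z(3) by (simp add: weak_less_def)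
    then show False using z(3) by (simp add: weak_less_def)
  qed
  then show "covered_by s w w'"
    using w w' ascent_move_weak_less[OF w m] unfolding covered_by_def by blast
qed

subsection \<open>Routes of prefixes\<close>

definition prefix_routes :: "nat list \<Rightarrow> nat list \<Rightarrow> edge list set" where
  "prefix_routes s w = {route s u | u v. w = u @ v}"

definition open_letters :: "nat list \<Rightarrow> nat list \<Rightarrow> nat set" where
  "open_letters s u = {a \<in> {1..length s}. 0 < count_list u a \<and> count_list u a < part s a}"

lemma finite_open_letters [simp]: "finite (open_letters s u)"
  by (simp add: open_letters_def)

lemma route_start_open_letters:
  "route_start s u = (if open_letters s u = {} then length s + 1 else Min (open_letters s u))"
  unfolding route_start_def open_letters_def Let_def ..

lemma route_start_cases:
  "route_start s u = length s + 1 \<or> route_start s u \<in> open_letters s u"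
  by (simp add: route_start_open_letters Min_in)

lemma route_start_bounds: "1 \<le> route_start s u" "route_start s u \<le> length s + 1"
  using route_start_cases[of s u] by (auto simp: open_letters_def)

lemma route_start_geI:
  assumes "y \<le> length s + 1" "\<And>b. b \<in> open_letters s u \<Longrightarrow> b < y \<Longrightarrow> False"
  shows "y \<le> route_start s u"
  using assms route_start_cases[of s u] by (metis not_le)

lemma route_start_le: "b \<in> open_letters s u \<Longrightarrow> route_start s u \<le> b"
  by (auto simp: route_start_open_letters)

lemma route_start_not_open:
  "a < route_start s u \<Longrightarrow> a \<notin> open_letters s u"
  using route_start_le by fastforce

lemma set_route:
  "set (route s u) = (\<lambda>a. (a, if a = length s + 1 then 1 else count_list u a)) ` {1..route_start s u}"
  by (auto simp: route_def)

lemma route_mem_iff: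
  "(a, k) \<in> set (route s u) \<longleftrightarrow>
     1 \<le> a \<and> a \<le> route_start s u \<and> k = (if a = length s + 1 then 1 else count_list u a)"
  by (auto simp: set_route)

lemma route_eqD:
  assumes "route s u = route s v" "1 \<le> a" "a \<le> length s" "a \<le> route_start s u"
  shows "count_list v a = count_list u a"
proof -
  have "(a, count_list u a) \<in> set (route s u)"
    using assms(2-4) by (simp add: route_mem_iff)
  then have "(a, count_list u a) \<in> set (route s v)" using assms(1) by simp
  then show ?thesis using assms(3) by (auto simp: route_mem_iff)
qed

lemma route_cong_count:
  assumes "\<And>a. count_list u a = count_list v a"
  shows "route s u = route s v"
  by (simp add: route_def route_start_def assms)

text \<open>Routes record no letter above the least open one, so an open \<open>b\<close> hides all
  counts above it.\<close>

lemma route_cong_open: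
  assumes b: "b \<in> open_letters s u" and eq: "\<And>a. a \<le> b \<Longrightarrow> count_list u a = count_list v a"
  shows "route s u = route s v"
proof -
  have o: "a \<in> open_letters s u \<longleftrightarrow> a \<in> open_letters s v" if "a \<le> b" for a
    using eq[OF that] by (simp add: open_letters_def)
  have "route_start s u \<le> b" "route_start s v \<le> b" using b o route_start_le by auto
  then have "route_start s u \<in> open_letters s u" "route_start s v \<in> open_letters s v"
    using route_start_cases[of s u] route_start_cases[of s v] b by (auto simp: open_letters_def)
  then have st: "route_start s u = route_start s v"
    using o \<open>route_start s u \<le> b\<close> \<open>route_start s v \<le> b\<close> route_start_le by (meson antisym)
  have bn: "b \<le> length s" using b by (simp add: open_letters_def)
  show ?thesis unfolding route_def st
    using \<open>route_start s v \<le> b\<close> bn by (auto intro!: eq)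
qed

lemma open_letter_recurs:
  assumes "stirling_perm s w" "w = p @ r" "b \<in> open_letters s p"
  shows "b \<in> set p" "b \<in> set r"
proof -
  have "count_list w b = part s b" using assms by (simp add: stirling_perm_def open_letters_def)
  then have "0 < count_list r b" using assms by (simp add: open_letters_def)
  then show "b \<in> set r" by (simp add: count_list_pos_iff)
  show "b \<in> set p" using assms(3) by (simp add: open_letters_def count_list_pos_iff)
qed

lemma letter_in_range:
  "stirling_perm s w \<Longrightarrow> x \<in> set w \<Longrightarrow> 1 \<le> x \<and> x \<le> length s"
  by (auto simp: stirling_perm_def)

text \<open>A smaller open letter would occur on both sides of \<open>y\<close>. So the route of
  \<open>p\<close> still shows how many \<open>y\<close>'s have been read; by the next lemma so does
  that of \<open>p @ [y]\<close>.\<close>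

lemma route_start_ge_next:
  assumes "stirling_perm s w" "w = p @ y # r"
  shows "y \<le> route_start s p"
proof (rule route_start_geI)
  show "y \<le> length s + 1" using letter_in_range[OF assms(1), of y] assms(2) by simp
  fix b assume b: "b \<in> open_letters s p" "b < y"
  then have "b \<in> set p" "b \<in> set r" using open_letter_recurs[OF assms b(1)] by auto
  then show False using stirling_perm_121[OF assms] b(2) by fastforce
qed

lemma route_start_ge_last:
  assumes "stirling_perm s w" "w = p @ y # r"
  shows "y \<le> route_start s (p @ [y])"
proof (rule route_start_geI)
  have w: "w = (p @ [y]) @ r" using assms by simp
  show "y \<le> length s + 1" using letter_in_range[OF assms(1), of y] assms(2) by simp
  fix b assume b: "b \<in> open_letters s (p @ [y])" "b < y"
  then have "b \<in> set p" "b \<in> set r" using open_letter_recurs[OF assms(1) w b(1)] by auto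
  then show False using stirling_perm_121[OF assms] b(2) by fastforce
qed

text \<open>The route of \<open>p @ q\<close> shows the count of its last letter, which is larger
  than in \<open>p\<close>.\<close>

lemma route_prefix_inj:
  assumes w: "stirling_perm s w" and p: "w = p @ q @ r" "q \<noteq> []"
  shows "route s p \<noteq> route s (p @ q)"
proof
  assume eq: "route s p = route s (p @ q)"
  obtain q' z where q: "q = q' @ [z]" using p(2) by (metis rev_exhaust)
  have wz: "w = (p @ q') @ z # r" using p q by simp
  have "z \<le> route_start s (p @ q)" using route_start_ge_last[OF w wz] q by simp
  then have "count_list p z = count_list (p @ q) z"
    using route_eqD[OF eq[symmetric]] letter_in_range[OF w, of z] wz by auto
  then show False using q by simp
qed

lemma prefix_routesE:
  assumes "route s u \<in> prefix_routes s w"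
  obtains p r where "w = p @ r"
    "\<forall>a. 1 \<le> a \<and> a \<le> length s \<and> a \<le> route_start s u \<longrightarrow> count_list p a = count_list u a"
proof -
  obtain p r where "route s u = route s p" "w = p @ r"
    using assms unfolding prefix_routes_def by blast
  then show ?thesis using that route_eqD by blast
qed

text \<open>This route shows one more \<open>y\<close> than \<open>u\<close> has but no further
  \<open>x\<close>, whereas beyond \<open>u\<close> a prefix of \<open>w\<close> reads
  \<open>x\<close> first.\<close>

lemma route_larger_notin:
  assumes w: "stirling_perm s w" and w': "stirling_perm s w'"
    and d: "w = u @ x # v" "w' = u @ y # v'" and xy: "x < y"
  shows "route s (u @ [y]) \<notin> prefix_routes s w"
proof
  assume "route s (u @ [y]) \<in> prefix_routes s w"
  then obtain p r where p: "w = p @ r"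
    and c: "\<forall>a. 1 \<le> a \<and> a \<le> length s \<and> a \<le> route_start s (u @ [y]) \<longrightarrow>
      count_list p a = count_list (u @ [y]) a"
    by (rule prefix_routesE)
  have y: "y \<le> route_start s (u @ [y])" using route_start_ge_last[OF w' d(2)] .
  have "1 \<le> x" "x \<le> length s" "1 \<le> y" "y \<le> length s"
    using letter_in_range[OF w, of x] letter_in_range[OF w', of y] d by simp_all
  then have cx: "count_list p x = count_list u x" and cy: "count_list p y = count_list u y + 1"
    using c[rule_format, of x] c[rule_format, of y] y xy by auto
  from p d(1) have "(\<exists>t. u = p @ t) \<or> (\<exists>t. p = u @ x # t)"
    by (auto simp: append_eq_append_conv2 Cons_eq_append_conv)
  then show False using cx cy by auto
qed

text \<open>This route shows an \<open>x\<close> but no \<open>y\<close> beyond those of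
  \<open>u\<close>, whereas \<open>w'\<close> reads another \<open>y\<close> directly after
  \<open>u\<close>, before any \<open>x\<close>.\<close>

lemma route_block_notin:
  assumes w': "w' = u @ y # v'" and x: "x \<in> set q" "x \<notin> set u" "1 \<le> x" "x < y" and y: "y \<notin> set q"
    "y \<le> route_start s (u @ q)" "y \<le> length s"
  shows "route s (u @ q) \<notin> prefix_routes s w'"
proof
  assume "route s (u @ q) \<in> prefix_routes s w'"
  then obtain p r where p: "w' = p @ r"
    and c: "\<forall>a. 1 \<le> a \<and> a \<le> length s \<and> a \<le> route_start s (u @ q) \<longrightarrow>
      count_list p a = count_list (u @ q) a"
    by (rule prefix_routesE)
  have "0 < count_list q x" using x(1) by (simp add: count_list_pos_iff)
  then have cx: "0 < count_list p x" and cy: "count_list p y = count_list u y"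
    using c[rule_format, of x] c[rule_format, of y] x y by auto
  from p w' have "(\<exists>t. u = p @ t) \<or> (\<exists>t. p = u @ y # t)"
    by (auto simp: append_eq_append_conv2 Cons_eq_append_conv)
  then show False using cx cy x(2) by (auto simp: count_list_pos_iff)
qed

text \<open>The larger of the two letters after the common prefix yields a route that the other word
  lacks.\<close>

lemma prefix_routes_inj:
  assumes "stirling_perm s w" "stirling_perm s w'" "prefix_routes s w = prefix_routes s w'"
  shows "w = w'"
proof (rule ccontr)
  assume ne: "w \<noteq> w'"
  obtain u x v y v' where d: "x \<noteq> y" "w = u @ x # v" "w' = u @ y # v'"
    using stirling_perm_diverge[OF assms(1,2) ne] .
  have "route s (u @ [x]) \<in> prefix_routes s w" "route s (u @ [y]) \<in> prefix_routes s w'"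
    unfolding prefix_routes_def d by force+
  then show False
    using route_larger_notin[OF assms(1,2) d(2,3)] route_larger_notin[OF assms(2,1) d(3,2)] d(1) assms(3)
    by (metis linorder_neqE_nat)
qed

lemma ascent_split_open:
  assumes w: "stirling_perm s w" and d: "ascent_split w u B a c v"
    and b: "B = b1 @ b2" "b1 \<noteq> []" "b2 \<noteq> []"
  shows "a \<in> open_letters s (u @ b1)"
proof -
  note D = d[unfolded ascent_split_def]
  note bd = ascent_split_bounds[OF w d]
  have "a \<in> set b1" using D b by (metis hd_append2 hd_in_set)
  moreover have "a \<in> set b2" using D b by (metis last_appendR last_in_set)
  moreover have "a \<in> {1..length s}" using bd(1-3) by auto
  moreover from this have "count_list w a = part s a" using w by (simp only: stirling_perm_def)
  ultimately show ?thesis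
    using D b by (auto simp: open_letters_def count_list_pos_iff[symmetric])
qed

text \<open>While the block \<open>B\<close> of \<open>a\<close> is being read, \<open>a\<close> is open and hides the letters above it, so the
  routes do not see whether \<open>c\<close> has already been read.\<close>

lemma prefix_routes_ascent:
  assumes w: "stirling_perm s w" and w': "stirling_perm s w'"
    and d: "ascent_split w u B a c v" and w'_eq: "w' = u @ c # B @ v"
  shows "route s (u @ B) \<in> prefix_routes s w - prefix_routes s w'"
    and "route s (u @ [c]) \<in> prefix_routes s w' - prefix_routes s w"
    and "prefix_routes s w - {route s (u @ B)} = prefix_routes s w' - {route s (u @ [c])}"
proof -
  note D = d[unfolded ascent_split_def]
  note bd = ascent_split_bounds[OF w d]
  have w_eq: "w = u @ B @ c # v" using D by simp
  obtain B1 where B1: "B = a # B1" using D by (cases B) auto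
  have 1: "route s (u @ B) \<in> prefix_routes s w"
    unfolding prefix_routes_def w_eq by force
  have 2: "route s (u @ [c]) \<in> prefix_routes s w'"
    unfolding prefix_routes_def w'_eq by force
  have 3: "route s (u @ [c]) \<notin> prefix_routes s w"
    using route_larger_notin[OF w w' _ w'_eq bd(2)] w_eq B1 by simp
  have "c \<le> route_start s (u @ B)" using route_start_ge_next[OF w, of "u @ B" c v] w_eq by simp
  moreover have "c \<notin> set B" using bd(5) by auto
  ultimately have 4: "route s (u @ B) \<notin> prefix_routes s w'"
    using route_block_notin[OF w'_eq, of a B] D bd by auto
  have mid: "route s (u @ b1) = route s (u @ c # b1)" if "B = b1 @ b2" "b1 \<noteq> []" "b2 \<noteq> []" for b1 b2
    using route_cong_open[OF ascent_split_open[OF w d that]] bd(2) by auto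
  have tl: "route s (u @ B @ c # v1) = route s (u @ c # B @ v1)" for v1
    by (intro route_cong_count) simp
  have 5: "r \<in> prefix_routes s w'" if r: "r \<in> prefix_routes s w" "r \<noteq> route s (u @ B)" for r
  proof -
    obtain p t where p: "r = route s p" "w = p @ t" using r(1) unfolding prefix_routes_def by blast
    then consider (1) u2 where "u = p @ u2" | (2) b1 b2 where "p = u @ b1" "B = b1 @ b2"
      | (3) v1 v2 where "p = u @ B @ c # v1" "v = v1 @ v2"
      unfolding w_eq by (auto simp: append_eq_append_conv2 Cons_eq_append_conv append_eq_Cons_conv)
    then show ?thesis
    proof cases
      case 1
      then show ?thesis using p(1) unfolding prefix_routes_def w'_eq by auto
    next
      case 2
      show ?thesis
      proof (cases "b1 = [] \<or> b2 = []")
        case True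
        then show ?thesis using 2 p(1) r(2) unfolding prefix_routes_def w'_eq by auto
      next
        case False
        then have "r = route s (u @ c # b1)" "w' = (u @ c # b1) @ b2 @ v"
          using mid[OF 2(2)] 2 p(1) w'_eq by auto
        then show ?thesis unfolding prefix_routes_def by blast
      qed
    next
      case 3
      then have "r = route s (u @ c # B @ v1)" "w' = (u @ c # B @ v1) @ v2"
        using tl p(1) w'_eq by auto
      then show ?thesis unfolding prefix_routes_def by blast
    qed
  qed
  have 6: "r \<in> prefix_routes s w" if r: "r \<in> prefix_routes s w'" "r \<noteq> route s (u @ [c])" for r
  proof -
    obtain p t where p: "r = route s p" "w' = p @ t" using r(1) unfolding prefix_routes_def by blast
    \<comment> \<open>The condition \<open>b2 \<noteq> []\<close> leaves the prefix
      \<open>u @ c # B\<close> to the third case, where it has the same letter counts as a prefix of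
      \<open>w\<close>.\<close>
    then consider (1) u2 where "u = p @ u2" | (2) b1 b2 where "p = u @ c # b1" "B = b1 @ b2" "b2 \<noteq> []"
      | (3) v1 v2 where "p = u @ c # B @ v1" "v = v1 @ v2"
      unfolding w'_eq by (fastforce simp: append_eq_append_conv2 Cons_eq_append_conv append_eq_Cons_conv)
    then show ?thesis
    proof cases
      case 1
      then show ?thesis using p(1) unfolding prefix_routes_def w_eq by auto
    next
      case 2
      then have "b1 \<noteq> []" using p(1) r(2) by auto
      then have "r = route s (u @ b1)" "w = (u @ b1) @ b2 @ c # v"
        using mid[OF 2(2)] 2 p(1) w_eq by auto
      then show ?thesis unfolding prefix_routes_def by blast
    next
      case 3
      then have "r = route s (u @ B @ c # v1)" "w = (u @ B @ c # v1) @ v2"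
        using tl p(1) w_eq by auto
      then show ?thesis unfolding prefix_routes_def by blast
    qed
  qed
  show "route s (u @ B) \<in> prefix_routes s w - prefix_routes s w'" using 1 4 by simp
  show "route s (u @ [c]) \<in> prefix_routes s w' - prefix_routes s w" using 2 3 by simp
  show "prefix_routes s w - {route s (u @ B)} = prefix_routes s w' - {route s (u @ [c])}"
    using 3 4 5 6 by blast
qed

text \<open>The route \<open>r'\<close> must be that of \<open>u @ [y]\<close>. That
  \<open>r\<close> is the only route of \<open>w\<close> missing from \<open>w'\<close> then
  determines the shape of \<open>w\<close> up to its next \<open>y\<close>.\<close>

lemma adjacent_routes_ascending:
  assumes w: "stirling_perm s w" and w': "stirling_perm s w'"
    and r: "prefix_routes s w - {r} = prefix_routes s w' - {r'}" "r \<in> prefix_routes s w" "r' \<in> prefix_routes s w'"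
    and d: "w = u @ x # v" "w' = u @ y # v'" and xy: "x < y"
  shows "ascent_move w w'"
proof -
  have "route s (u @ [y]) \<in> prefix_routes s w'" unfolding prefix_routes_def d(2) by force
  then have r': "r' = route s (u @ [y])" using route_larger_notin[OF w w' d xy] r(1) by blast
  have "y \<in> set (x # v)" using remaining_letter(2)[OF w w' d, of y] by simp
  then obtain q t where q: "x # v = q @ y # t" "y \<notin> set q" by (meson split_list_first)
  obtain q0 where q0: "q = x # q0" using q xy by (cases q) auto
  have wq: "w = u @ q @ y # t" using d q by simp
  have xn: "1 \<le> x" "y \<le> length s" using letter_in_range[OF w, of x] letter_in_range[OF w', of y] d by auto
  have new: "b \<notin> set u" if "b \<in> set (q @ y # t)" "b < y" for b
    using smaller_letter_new[OF w w' wq d(2)] that by auto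
  have xu: "x \<notin> set u" using new[of x] q0 xy by simp
  \<comment> \<open>Every nonempty prefix of \<open>q\<close> after which the count of
    \<open>y\<close> is still visible yields a route missing from \<open>w'\<close>, hence
    \<open>r\<close>.\<close>
  have unique: "r = route s (u @ q1)" if q1: "q = q1 @ q2" "q1 \<noteq> []" "y \<le> route_start s (u @ q1)" for q1 q2
  proof -
    have "x \<in> set q1" using q1 q0 by (cases q1) auto
    then have "route s (u @ q1) \<notin> prefix_routes s w'"
      using route_block_notin[OF d(2), of x q1] xu xn xy q1 q(2) by auto
    moreover have "route s (u @ q1) \<in> prefix_routes s w"
      unfolding prefix_routes_def wq q1(1) by force
    ultimately show ?thesis using r(1) by blast
  qed
  \<comment> \<open>The routes just before and just after the first letter of \<open>q\<close> above
    \<open>y\<close> would both qualify as \<open>r\<close>, yet they differ.\<close>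
  have small: "\<forall>z\<in>set q. z < y"
  proof (rule ccontr)
    assume "\<not> (\<forall>z\<in>set q. z < y)"
    then have "\<exists>z\<in>set q. y < z" using q(2) by (metis linorder_neqE_nat)
    then obtain q1 z q2 where z: "q = q1 @ z # q2" "y < z" "\<forall>b\<in>set q1. \<not> y < b"
      using split_list_first_prop[of q "\<lambda>z. y < z"] by blast
    have q1: "q1 \<noteq> []" using z q0 xy by auto
    have wz: "w = (u @ q1) @ z # q2 @ y # t" using wq z by simp
    have "z \<le> route_start s (u @ q1)" "z \<le> route_start s (u @ (q1 @ [z]))"
      using route_start_ge_next[OF w wz] route_start_ge_last[OF w wz] by auto
    then have "r = route s (u @ q1)" "r = route s (u @ (q1 @ [z]))"
      using unique[of q1 "z # q2"] unique[of "q1 @ [z]" q2] z q1 by auto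
    then show False using route_prefix_inj[OF w, of "u @ q1" "[z]" "q2 @ y # t"] wz by simp
  qed
  have whole: "r = route s (u @ q)"
    using unique[of q "[]"] q0 route_start_ge_next[OF w, of "u @ q" y t] wq by simp
  have xt: "x \<notin> set t"
    using stirling_perm_121[OF w, of "u @ q" y t x] wq q0 xy by auto
  obtain b1 q2 where b: "q = b1 @ x # q2" "x \<notin> set q2" using split_list_last[of x q] q0 by auto
  \<comment> \<open>If letters followed the last \<open>x\<close> of \<open>q\<close>, the prefix
    ending with that \<open>x\<close> would be a second candidate for \<open>r\<close>.\<close>
  have "q2 = []"
  proof (rule ccontr)
    assume q2: "q2 \<noteq> []"
    have wB: "w = (u @ b1 @ [x]) @ q2 @ y # t" using wq b by simp
    have "y \<le> route_start s (u @ b1 @ [x])"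
    proof (rule route_start_geI)
      show "y \<le> length s + 1" using xn by simp
      \<comment> \<open>Such an \<open>e\<close> lies between two \<open>x\<close>'s and recurs
        after the second, so 121-avoidance gives both \<open>e \<le> x\<close> and
        \<open>x \<le> e\<close>.\<close>
      fix e assume e: "e \<in> open_letters s (u @ b1 @ [x])" "e < y"
      have e1: "e \<in> set (u @ b1 @ [x])" and e2: "e \<in> set (q2 @ y # t)"
        using open_letter_recurs[OF w wB e(1)] by blast+
      have "e \<notin> set u" using new[of e] e2 e(2) b by auto
      moreover have ex: "e \<noteq> x" using e2 b(2) xt xy by auto
      ultimately have eb: "e \<in> set b1" using e1 by auto
      have "x \<le> e" using stirling_perm_121[OF w, of "u @ b1" x "q2 @ y # t" e] wB eb e2 by simp
      moreover obtain c1 c2 where c: "b1 = c1 @ e # c2" using eb by (meson split_list)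
      have "x \<in> set c1"
      proof (cases c1)
        case Nil
        then show ?thesis using c b q0 ex by simp
      next
        case (Cons f fs)
        then show ?thesis using c b q0 by simp
      qed
      then have "e \<le> x"
        using stirling_perm_121[OF w, of "u @ c1" e "c2 @ [x] @ q2 @ y # t" x] wB c by simp
      ultimately show False using ex by simp
    qed
    then have "r = route s (u @ b1 @ [x])" using unique[of "b1 @ [x]" q2] b by simp
    then show False using route_prefix_inj[OF w, of "u @ b1 @ [x]" q2 "y # t"] wB whole b q2 by simp
  qed
  then have "last q = x" using b by simp
  moreover have "hd q = x" "q \<noteq> []" using q0 by simp_all
  ultimately have sp: "ascent_split w u q x y t"
    unfolding ascent_split_def using wq xu xt xy by simp
  \<comment> \<open>The move turns \<open>w\<close> into a word with the same routes as
    \<open>w'\<close>, and words are determined by their routes.\<close>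
  define z where "z = u @ y # q @ t"
  have m: "ascent_move w z" unfolding ascent_move_def z_def using sp by blast
  have z: "stirling_perm s z" using ascent_move_stirling_perm[OF w m] .
  note pr = prefix_routes_ascent[OF w z sp z_def]
  have "prefix_routes s z = insert r' (prefix_routes s w - {r})"
    using pr(2,3) unfolding r' whole by (metis DiffD1 insert_Diff)
  also have "\<dots> = prefix_routes s w'" using r(1,3) by (metis insert_Diff)
  finally have "prefix_routes s z = prefix_routes s w'" .
  then have "z = w'" using prefix_routes_inj[OF z w'] by simp
  then show ?thesis using m by simp
qed

lemma ascent_move_iff_prefix_routes:
  assumes w: "stirling_perm s w" and w': "stirling_perm s w'"
  shows "ascent_move w w' \<or> ascent_move w' w \<longleftrightarrow> w \<noteq> w' \<and>
    (\<exists>r\<in>prefix_routes s w. \<exists>r'\<in>prefix_routes s w'. prefix_routes s w - {r} = prefix_routes s w' - {r'})"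
    (is "?L \<longleftrightarrow> ?R")
proof
  have *: "w \<noteq> w' \<and>
    (\<exists>r\<in>prefix_routes s w. \<exists>r'\<in>prefix_routes s w'. prefix_routes s w - {r} = prefix_routes s w' - {r'})"
    if h: "stirling_perm s w" "stirling_perm s w'" "ascent_move w w'" for w w'
  proof -
    obtain u B a c v where d: "ascent_split w u B a c v" and w': "w' = u @ c # B @ v"
      using h(3) unfolding ascent_move_def by blast
    note pr = prefix_routes_ascent[OF h(1,2) d w']
    show ?thesis
      using pr(1,2) by (intro conjI bexI[of _ "route s (u @ B)"] bexI[of _ "route s (u @ [c])"] pr(3)) auto
  qed
  assume ?L
  then show ?R
  proof
    assume "ascent_move w w'"
    then show ?R using *[OF w w'] by simp
  next
    assume "ascent_move w' w"
    then show ?R using *[OF w' w] by (metis (no_types))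
  qed
next
  assume R: ?R
  then obtain r r' where r: "r \<in> prefix_routes s w" "r' \<in> prefix_routes s w'"
    "prefix_routes s w - {r} = prefix_routes s w' - {r'}" by auto
  have ne: "w \<noteq> w'" using R by simp
  obtain u x v y v' where d: "x \<noteq> y" "w = u @ x # v" "w' = u @ y # v'"
    using stirling_perm_diverge[OF w w' ne] .
  from d(1) consider "x < y" | "y < x" by linarith
  then show ?L
    using adjacent_routes_ascending[OF w w' r(3,1,2) d(2,3)]
      adjacent_routes_ascending[OF w' w r(3)[symmetric] r(2,1) d(3,2)] by cases simp_all
qed

subsection \<open>Simplices\<close>

text \<open>Affine independence makes every point of \<open>C\<close> extreme in the hull, and
  extreme points of a hull belong to every generating set.\<close>

lemma convex_hull_vertices_subset:
  fixes C D :: "'a::real_vector set"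
  assumes "finite C" "\<not> affine_dependent C" "convex hull C = convex hull D"
  shows "C \<subseteq> D"
proof
  fix a assume a: "a \<in> C"
  then have "a \<notin> convex hull (C - {a})"
    using assms(2) convex_hull_subset_affine_hull unfolding affine_dependent_def by blast
  then have "a extreme_point_of convex hull (insert a (C - {a}))"
    using assms(1) by (intro extreme_point_of_convex_hull_insert) auto
  then show "a \<in> D" using a assms(3) by (metis extreme_point_of_convex_hull insert_Diff)
qed

lemma convex_hull_vertices_eq:
  fixes C D :: "'a::real_vector set"
  assumes "finite C" "\<not> affine_dependent C" "finite D" "\<not> affine_dependent D" "convex hull C = convex hull D"
  shows "C = D"
  using convex_hull_vertices_subset[OF assms(1,2,5)] convex_hull_vertices_subset[OF assms(3,4)] assms(5)
  by auto

lemma affine_independent_Diff: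
  "\<not> affine_dependent C \<Longrightarrow> \<not> affine_dependent (C - D)"
  using affine_dependent_subset by blast

text \<open>The vertex sets hidden in \<open>simplex_facet\<close> can only be \<open>C\<close> and
  \<open>D\<close>, and the common facet determines its own vertices as well.\<close>

lemma common_simplex_facet_iff:
  fixes C D :: "'a::real_vector set"
  assumes "finite C" "\<not> affine_dependent C" "finite D" "\<not> affine_dependent D"
  shows "(\<exists>F. simplex_facet F (convex hull C) \<and> simplex_facet F (convex hull D)) \<longleftrightarrow>
    (\<exists>a\<in>C. \<exists>b\<in>D. C - {a} = D - {b})"
proof
  assume "\<exists>F. simplex_facet F (convex hull C) \<and> simplex_facet F (convex hull D)"
  then obtain F where F: "simplex_facet F (convex hull C)" "simplex_facet F (convex hull D)" by blast
  obtain C' a where C': "finite C'" "\<not> affine_dependent C'" "convex hull C = convex hull C'" "a \<in> C'"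
    "F = convex hull (C' - {a})" using F(1) unfolding simplex_facet_def by blast
  obtain D' b where D': "finite D'" "\<not> affine_dependent D'" "convex hull D = convex hull D'" "b \<in> D'"
    "F = convex hull (D' - {b})" using F(2) unfolding simplex_facet_def by blast
  have "C' = C" "D' = D"
    using convex_hull_vertices_eq[OF assms(1,2) C'(1-3)] convex_hull_vertices_eq[OF assms(3,4) D'(1-3)]
    by simp_all
  moreover have "C' - {a} = D' - {b}"
    by (rule convex_hull_vertices_eq[OF finite_Diff[OF C'(1)] affine_independent_Diff[OF C'(2)]
          finite_Diff[OF D'(1)] affine_independent_Diff[OF D'(2)] trans[OF C'(5)[symmetric] D'(5)]])
  ultimately show "\<exists>a\<in>C. \<exists>b\<in>D. C - {a} = D - {b}" using C'(4) D'(4) by blast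
next
  assume "\<exists>a\<in>C. \<exists>b\<in>D. C - {a} = D - {b}"
  then obtain a b where ab: "a \<in> C" "b \<in> D" "C - {a} = D - {b}" by blast
  have "simplex_facet (convex hull (C - {a})) (convex hull C)"
    unfolding simplex_facet_def using assms(1,2) ab(1) by blast
  moreover have "simplex_facet (convex hull (C - {a})) (convex hull D)"
    unfolding simplex_facet_def ab(3) using assms(3,4) ab(2) by blast
  ultimately show "\<exists>F. simplex_facet F (convex hull C) \<and> simplex_facet F (convex hull D)" by blast
qed

subsection \<open>Flows\<close>

lemma lookup_scaleR [simp]:
  "Poly_Mapping.lookup (c *\<^sub>R f) e = c *\<^sub>R Poly_Mapping.lookup (f :: 'a \<Rightarrow>\<^sub>0 'b::real_vector) e"
proof -
  have "{i. c *\<^sub>R Poly_Mapping.lookup f i \<noteq> 0} \<subseteq> Poly_Mapping.keys f"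
    by (auto simp: in_keys_iff)
  then have "finite {i. c *\<^sub>R Poly_Mapping.lookup f i \<noteq> 0}" using finite_keys finite_subset by blast
  then show ?thesis unfolding scaleR_poly_mapping_def by simp
qed

lemma linear_lookup: "linear (\<lambda>f :: 'a \<Rightarrow>\<^sub>0 'b::real_vector. Poly_Mapping.lookup f e)"
  by (rule linearI) (simp_all add: lookup_add)

lemma lookup_route_vector: "Poly_Mapping.lookup (route_vector p) e = of_bool (e \<in> set p)"
  by (simp add: route_vector_def lookup_sum lookup_single when_def)

lemma linear_netflow: "linear (\<lambda>f. netflow s f v)"
  by (rule linearI)
    (simp_all add: netflow_def lookup_add sum.distrib sum_distrib_left right_diff_distrib)

text \<open>For \<open>i \<le> n\<close> the bump, the source edges and the dip have lower indices
  \<open>0\<close>, \<open>1\<close> to \<open>s_i - 1\<close>, and \<open>s_i\<close>. For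
  \<open>i = n + 1\<close> the convention \<open>s_(n+1) = 2\<close> leaves a single source
  edge.\<close>

lemma edges_eq: "edges s = insert (length s + 1, 1) (SIGMA i:{1..length s}. {0..part s i})"
proof (rule set_eqI)
  fix e :: edge
  obtain i k where e: "e = (i, k)" by (cases e)
  consider "i = length s + 1" | "i \<noteq> length s + 1" by blast
  then show "e \<in> edges s \<longleftrightarrow> e \<in> insert (length s + 1, 1) (SIGMA i:{1..length s}. {0..part s i})"
  proof cases
    case 1
    then show ?thesis unfolding e edges_def source_edges_def bumps_def dips_def by auto
  next
    case 2
    then show ?thesis unfolding e edges_def source_edges_def bumps_def dips_def by auto
  qed
qed

lemma finite_edges: "finite (edges s)"
  by (simp add: edges_eq)

lemma netflow_single:
  assumes "e \<in> edges s"
  shows "netflow s (Poly_Mapping.single e 1) v = of_bool (tail s e = v) - of_bool (head s e = v)"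
proof -
  have "(\<Sum>e'\<in>{e' \<in> edges s. P e'}. Poly_Mapping.lookup (Poly_Mapping.single e 1) e') = (of_bool (P e) :: real)"
    for P using assms finite_edges by (simp add: lookup_single when_def)
  then show ?thesis by (simp add: netflow_def)
qed

text \<open>Contributions at intermediate vertices telescope; distinctness lets the path's vector be
  summed edge by edge.\<close>

lemma netflow_route_vector:
  assumes "dipath s x p y" "distinct p"
  shows "netflow s (route_vector p) v = of_bool (x = v) - of_bool (y = v)"
  using assms
proof (induction p arbitrary: x)
  case Nil
  then show ?case by (simp add: route_vector_def netflow_def)
next
  case (Cons e p)
  have "route_vector (e # p) = Poly_Mapping.single e 1 + route_vector p"
    using Cons.prems(2) by (simp add: route_vector_def)
  then have "netflow s (route_vector (e # p)) v = netflow s (Poly_Mapping.single e 1) v + netflow s (route_vector p) v"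
    using linear_add[OF linear_netflow] by simp
  then show ?case using Cons.IH[of "head s e"] Cons.prems netflow_single[of e s v] by auto
qed

lemma dipath_edges: "dipath s x p y \<Longrightarrow> set p \<subseteq> edges s"
  by (induction p arbitrary: x) auto

lemma distinct_route: "distinct (route s u)"
  by (simp add: route_def distinct_map inj_on_def)

lemma route_vector_in_flow_polytope:
  assumes "p \<in> routes s" "distinct p"
  shows "route_vector p \<in> flow_polytope s"
proof -
  have d: "dipath s (- 1) p (int (length s))" using assms(1) by (simp add: routes_def)
  show ?thesis unfolding flow_polytope_def
    using netflow_route_vector[OF d assms(2)] dipath_edges[OF d]
    by (auto simp: lookup_route_vector in_keys_iff)
qed

lemma dipath_bumps_dips:
  assumes "k \<le> length s" "\<And>a. 1 \<le> a \<Longrightarrow> a \<le> k \<Longrightarrow> f a = 0 \<or> f a = part s a"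
  shows "dipath s (int (length s) - int k) (map (\<lambda>a. (a, f a)) (rev [1..<k + 1])) (int (length s))"
  using assms
proof (induction k)
  case 0
  then show ?case by simp
next
  case (Suc k)
  have f: "f (Suc k) = 0 \<or> f (Suc k) = part s (Suc k)" using Suc.prems(2) by simp
  have "(Suc k, f (Suc k)) \<in> edges s" using f Suc.prems(1) by (auto simp: edges_eq)
  moreover have "tail s (Suc k, f (Suc k)) = int (length s) - int (Suc k)"
    using f Suc.prems(1) by (auto simp: tail_def source_edges_def)
  moreover have "head s (Suc k, f (Suc k)) = int (length s) - int k" by (simp add: head_def)
  ultimately show ?case using Suc by simp
qed

text \<open>Letters below \<open>route_start s u\<close> are not open, so their edges are bumps or
  dips. The first edge is a source edge, as its letter is open or equals
  \<open>n + 1\<close>.\<close>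

lemma route_in_routes:
  assumes w: "stirling_perm s w" and p: "w = u @ v"
  shows "route s u \<in> routes s"
proof -
  define f where "f a = (if a = length s + 1 then 1 else count_list u a)" for a
  obtain k where k: "route_start s u = Suc k" using route_start_bounds(1)[of s u] by (cases "route_start s u") auto
  have kn: "k \<le> length s" using route_start_bounds(2)[of s u] k by simp
  have r: "route s u = (Suc k, f (Suc k)) # map (\<lambda>a. (a, f a)) (rev [1..<k + 1])"
    unfolding route_def k f_def by simp
  have "dipath s (int (length s) - int k) (map (\<lambda>a. (a, f a)) (rev [1..<k + 1])) (int (length s))"
  proof (rule dipath_bumps_dips[OF kn])
    fix a assume a: "1 \<le> a" "a \<le> k"
    then have "a \<notin> open_letters s u" using k route_start_not_open[of a s u] by simp
    moreover have "a \<in> {1..length s}" using a kn by simp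
    moreover from this have "count_list u a + count_list v a = part s a"
      using w unfolding stirling_perm_def p by auto
    ultimately show "f a = 0 \<or> f a = part s a" unfolding open_letters_def f_def by auto
  qed
  moreover have "(Suc k, f (Suc k)) \<in> source_edges s"
    using route_start_cases[of s u] kn unfolding k open_letters_def source_edges_def f_def by auto
  then have "tail s (Suc k, f (Suc k)) = - 1" "(Suc k, f (Suc k)) \<in> edges s"
    by (simp_all add: tail_def edges_def)
  ultimately show ?thesis unfolding r routes_def by (simp add: head_def)
qed

section \<open>Coherence of routes of comparable prefixes\<close>

lemma initial_less_iff:
  assumes "p \<noteq> []" "q \<noteq> []" "last p \<noteq> last q"
  shows "initial_less p q \<longleftrightarrow> in_less (last p) (last q)"
proof
  assume "initial_less p q"
  then obtain p' q' e f r where h: "p = p' @ e # r" "q = q' @ f # r" "in_less e f"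
    unfolding initial_less_def by blast
  then have "r = []" using assms(3) by (cases r) auto
  then show "in_less (last p) (last q)" using h by simp
next
  assume l: "in_less (last p) (last q)"
  have "p = butlast p @ last p # []" "q = butlast q @ last q # []" using assms by simp_all
  then show "initial_less p q" unfolding initial_less_def using assms(3) l by blast
qed

lemma final_less_iff:
  assumes "p \<noteq> []" "q \<noteq> []" "hd p \<noteq> hd q"
  shows "final_less s p q \<longleftrightarrow> out_less s (hd p) (hd q)"
proof
  assume "final_less s p q"
  then obtain p' q' e f r where h: "p = r @ e # p'" "q = r @ f # q'" "out_less s e f"
    unfolding final_less_def by blast
  then have "r = []" using assms(3) by (cases r) auto
  then show "out_less s (hd p) (hd q)" using h by simp
next
  assume l: "out_less s (hd p) (hd q)"
  have "p = [] @ hd p # tl p" "q = [] @ hd q # tl q" using assms by simp_all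
  then show "final_less s p q" unfolding final_less_def using assms(3) l by blast
qed

lemma dipath_head_last: "dipath s x p y \<Longrightarrow> p \<noteq> [] \<Longrightarrow> head s (last p) = y"
proof (induction p arbitrary: x)
  case (Cons e p)
  then show ?case by (cases "p = []") auto
qed simp

lemma tail_inner:
  assumes "(a, k) \<in> edges s" "tail s (a, k) = v" "0 \<le> v"
  shows "int a = int (length s) - v \<and> (k = 0 \<or> k = part s a) \<and> 1 \<le> a \<and> a \<le> length s"
  using assms unfolding tail_def edges_def bumps_def dips_def by (auto split: if_splits)

text \<open>Edges entering, or leaving, the same inner vertex share their letter, and the framing
  orders them by its count. Since all counts compare the same way, so do both ends of a common
  subpath.\<close>

lemma coherent_routes:
  assumes s: "composition s" and mono: "\<And>a. count_list u a \<le> count_list u' a"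
  shows "coherent s (route s u) (route s u')" "coherent s (route s u') (route s u)"
proof -
  \<comment> \<open>Strict comparisons at both ends are proved, so that exchanging the two routes
    also settles the second claim.\<close>
  have key: "in_less (last p1) (last q1) \<and> \<not> in_less (last q1) (last p1) \<and>
      out_less s (hd p2) (hd q2) \<and> \<not> out_less s (hd q2) (hd p2) \<and>
      p1 \<noteq> [] \<and> q1 \<noteq> [] \<and> p2 \<noteq> [] \<and> q2 \<noteq> []"
    if x: "x \<in> {0..<int (length s)}" and y: "y \<in> {0..<int (length s)}"
      and P: "route s u = p1 @ m @ p2" and Q: "route s u' = q1 @ m' @ q2"
      and d: "dipath s (- 1) p1 x" "dipath s (- 1) q1 x"
        "dipath s y p2 (int (length s))" "dipath s y q2 (int (length s))"
      and l: "last p1 \<noteq> last q1" "hd p2 \<noteq> hd q2"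
    for x y p1 q1 m m' p2 q2
  proof -
    have ne: "p1 \<noteq> []" "q1 \<noteq> []" "p2 \<noteq> []" "q2 \<noteq> []" using x y d by auto
    obtain b k where b: "last p1 = (b, k)" by (cases "last p1")
    obtain b' k' where b': "last q1 = (b', k')" by (cases "last q1")
    obtain a j where a: "hd p2 = (a, j)" by (cases "hd p2")
    obtain a' j' where a': "hd q2 = (a', j')" by (cases "hd q2")
    have "head s (b, k) = x" "head s (b', k') = x"
      using dipath_head_last[OF d(1) ne(1)] dipath_head_last[OF d(2) ne(2)] b b' by simp_all
    then have bb: "b' = b" by (auto simp: head_def)
    have "(b, k) \<in> set (route s u)" "(b', k') \<in> set (route s u')"
      unfolding P Q using ne b b' by (metis UnI1 last_in_set set_append)+
    then have kk: "k < k'" using l(1) b b' bb mono[of b] by (auto simp: route_mem_iff split: if_splits)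
    have "(a, j) \<in> edges s \<and> tail s (a, j) = y" "(a', j') \<in> edges s \<and> tail s (a', j') = y"
      using d(3,4) ne(3,4) a a' by (cases p2; cases q2; simp)+
    then have A: "int a = int (length s) - y" "j = 0 \<or> j = part s a" "1 \<le> a" "a \<le> length s"
      "int a' = int (length s) - y" "j' = 0 \<or> j' = part s a'"
      using tail_inner[of a j s y] tail_inner[of a' j' s y] y by auto
    then have aa: "a' = a" by linarith
    have "(a, j) \<in> set (route s u)" "(a', j') \<in> set (route s u')"
      unfolding P Q using ne a a' by (metis UnI2 hd_in_set set_append)+
    then have "j \<le> j'" using mono[of a] aa A by (auto simp: route_mem_iff)
    then have "j = 0" "j' = part s a" using A aa l(2) a a' by auto
    then show ?thesis
      using ne kk b b' bb a a' aa A part_pos[OF s A(3,4)] unfolding in_less_def out_less_def by auto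
  qed
  show "coherent s (route s u) (route s u')" unfolding coherent_def
  proof (intro allI ballI impI, elim conjE)
    fix p1 q1 m p2 q2 x y
    assume h: "x \<in> {0..<int (length s)}" "y \<in> {0..<int (length s)}"
      "route s u = p1 @ m @ p2" "route s u' = q1 @ m @ q2"
      "dipath s (- 1) p1 x" "dipath s (- 1) q1 x"
        "dipath s y p2 (int (length s))" "dipath s y q2 (int (length s))"
      and l: "last p1 \<noteq> last q1" "hd p2 \<noteq> hd q2"
    from key[OF h l] show "initial_less p1 q1 = final_less s p2 q2"
      using l by (simp add: initial_less_iff final_less_iff)
  qed
  show "coherent s (route s u') (route s u)" unfolding coherent_def
  proof (intro allI ballI impI, elim conjE)
    fix p1 q1 m p2 q2 x y
    assume h: "x \<in> {0..<int (length s)}" "y \<in> {0..<int (length s)}"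
      "route s u' = p1 @ m @ p2" "route s u = q1 @ m @ q2"
      "dipath s (- 1) p1 x" "dipath s (- 1) q1 x"
        "dipath s y p2 (int (length s))" "dipath s y q2 (int (length s))"
      and l: "last p1 \<noteq> last q1" "hd p2 \<noteq> hd q2"
    from key[OF h(1,2,4,3,6,5,8,7) l[symmetric]] show "initial_less p1 q1 = final_less s p2 q2"
      using l by (simp add: initial_less_iff final_less_iff)
  qed
qed

subsection \<open>The simplex of a Stirling permutation\<close>

definition prefix_vector :: "nat list \<Rightarrow> nat list \<Rightarrow> nat \<Rightarrow> (edge \<Rightarrow>\<^sub>0 real)" where
  "prefix_vector s w i = route_vector (route s (take i w))"

text \<open>The count includes position \<open>j\<close> itself, so the \<open>t\<close>-th copy of
  \<open>a\<close> gives \<open>(a, t)\<close>.\<close>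

definition new_edge :: "nat list \<Rightarrow> nat \<Rightarrow> edge" where
  "new_edge w j = (w ! j, count_list (take (Suc j) w) (w ! j))"

lemma lookup_prefix_vector_new:
  assumes w: "stirling_perm s w" and j: "j < length w"
  shows "Poly_Mapping.lookup (prefix_vector s w (Suc j)) (new_edge w j) = 1"
proof -
  have w_eq: "w = take j w @ w ! j # drop (Suc j) w" using j by (simp add: id_take_nth_drop)
  have "w ! j \<le> route_start s (take (Suc j) w)"
    using route_start_ge_last[OF w w_eq] j by (simp add: take_Suc_conv_app_nth)
  moreover have "1 \<le> w ! j \<and> w ! j \<le> length s" using letter_in_range[OF w] j by simp
  ultimately show ?thesis
    by (simp add: prefix_vector_def new_edge_def lookup_route_vector route_mem_iff)
qed

text \<open>Prefixes of length at most \<open>j\<close> contain the letter \<open>w ! j\<close>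
  fewer times than the edge records. With the preceding lemma this makes the family
  triangular.\<close>

lemma lookup_prefix_vector_old:
  assumes w: "stirling_perm s w" and j: "j < length w" "i \<le> j"
  shows "Poly_Mapping.lookup (prefix_vector s w i) (new_edge w j) = 0"
proof -
  have "take j w = take i w @ drop i (take j w)"
    using j(2) by (metis append_take_drop_id min.absorb1 take_take)
  then have "count_list (take i w) (w ! j) \<le> count_list (take j w) (w ! j)"
    by (metis count_list_append le_add1)
  moreover have "count_list (take (Suc j) w) (w ! j) = Suc (count_list (take j w) (w ! j))"
    using j(1) by (simp add: take_Suc_conv_app_nth)
  moreover have "w ! j \<noteq> length s + 1" using letter_in_range[OF w, of "w ! j"] j(1) by auto
  ultimately show ?thesis
    by (simp add: prefix_vector_def new_edge_def lookup_route_vector route_mem_iff)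
qed

text \<open>A flow vanishing on all new edges of a Stirling permutation thus vanishes on every edge
  with letter at most \<open>n\<close> other than the bumps.\<close>

lemma new_edge_surj:
  assumes "1 \<le> t" "t \<le> count_list w a"
  shows "\<exists>j<length w. new_edge w j = (a, t)"
  using assms
proof (induction w rule: rev_induct)
  case Nil
  then show ?case by simp
next
  case (snoc z w)
  show ?case
  proof (cases "t \<le> count_list w a")
    case True
    then obtain j where "j < length w" "new_edge w j = (a, t)" using snoc by blast
    then show ?thesis by (intro exI[of _ j]) (auto simp: new_edge_def nth_append)
  next
    case False
    then have "z = a" "t = Suc (count_list w a)" using snoc.prems by (auto split: if_splits)
    then show ?thesis by (intro exI[of _ "length w"]) (auto simp: new_edge_def)
  qed
qed

lemma route_Nil: "set (route s []) = insert (length s + 1, 1) ((\<lambda>a. (a, 0)) ` {1..length s})"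
proof -
  have "route_start s [] = length s + 1" by (simp add: route_start_open_letters open_letters_def)
  then have "(a, k) \<in> set (route s []) \<longleftrightarrow>
      (a, k) \<in> insert (length s + 1, 1) ((\<lambda>a. (a, 0)) ` {1..length s})" for a k
    by (auto simp: route_mem_iff)
  then show ?thesis by (intro set_eqI) (metis prod.collapse)
qed

lemma inj_on_prefix_vector:
  assumes w: "stirling_perm s w"
  shows "inj_on (prefix_vector s w) {0..length w}"
proof -
  have *: "prefix_vector s w i \<noteq> prefix_vector s w k" if "i < k" "k \<le> length w" for i k
  proof -
    obtain j where j: "k = Suc j" "i \<le> j" using \<open>i < k\<close> by (cases k) auto
    then show ?thesis
      using lookup_prefix_vector_new[OF w, of j] lookup_prefix_vector_old[OF w, of j i] \<open>k \<le> length w\<close> by auto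
  qed
  show ?thesis
  proof (rule inj_onI)
    fix i k assume "i \<in> {0..length w}" "k \<in> {0..length w}" "prefix_vector s w i = prefix_vector s w k"
    then show "i = k" using *[of i k] *[of k i] by (cases i k rule: linorder_cases) auto
  qed
qed

text \<open>The coordinate at \<open>new_edge w k\<close> vanishes on the span of the earlier
  vectors but not on the next one.\<close>

lemma independent_prefix_vectors:
  assumes w: "stirling_perm s w" and k: "k \<le> length w"
  shows "independent (prefix_vector s w ` {0..k})"
  using k
proof (induction k)
  case 0
  have "Poly_Mapping.lookup (prefix_vector s w 0) (length s + 1, 1) = 1"
    by (simp add: prefix_vector_def lookup_route_vector route_Nil)
  then have "prefix_vector s w 0 \<noteq> 0" by (metis lookup_zero zero_neq_one)
  then show ?case by simp
next
  case (Suc k)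
  have "subspace {f. Poly_Mapping.lookup f (new_edge w k) = (0 :: real)}"
    using linear_subspace_kernel[OF linear_lookup] .
  moreover have "prefix_vector s w ` {0..k} \<subseteq> {f. Poly_Mapping.lookup f (new_edge w k) = 0}"
    using lookup_prefix_vector_old[OF w, of k] Suc.prems by auto
  ultimately have "span (prefix_vector s w ` {0..k}) \<subseteq> {f. Poly_Mapping.lookup f (new_edge w k) = 0}"
    by (intro span_minimal)
  then have "prefix_vector s w (Suc k) \<notin> span (prefix_vector s w ` {0..k})"
    using lookup_prefix_vector_new[OF w, of k] Suc.prems by auto
  then show ?case using Suc by (simp add: atLeast0_atMost_Suc independent_insertI)
qed

lemma sum_eq_single:
  fixes f :: "'a \<Rightarrow> 'b::comm_monoid_add"
  assumes "finite A" "a \<in> A" "\<And>x. x \<in> A \<Longrightarrow> x \<noteq> a \<Longrightarrow> f x = 0"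
  shows "sum f A = f a"
  using assms by (simp add: sum.remove sum.neutral)

lemma flow_on_bumps:
  fixes f :: "edge \<Rightarrow>\<^sub>0 real"
  assumes e: "\<And>e. e \<notin> edges s \<Longrightarrow> Poly_Mapping.lookup f e = 0"
    and n: "\<And>v. v \<in> {0..<int (length s)} \<Longrightarrow> netflow s f v = 0"
    and z: "\<And>a t. 1 \<le> a \<Longrightarrow> a \<le> length s \<Longrightarrow> 1 \<le> t \<Longrightarrow> t \<le> part s a \<Longrightarrow>
      Poly_Mapping.lookup f (a, t) = 0"
  shows "f = Poly_Mapping.lookup f (length s + 1, 1) *\<^sub>R route_vector (route s [])"
proof -
  define c where "c = Poly_Mapping.lookup f (length s + 1, 1)"
  \<comment> \<open>The bump for \<open>i \<le> n\<close>, and the edge \<open>(n + 1, 1)\<close>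
    for \<open>i = n + 1\<close>. Conservation at each inner vertex makes the flow constant along
    these edges.\<close>
  define g where "g i = (i, of_bool (i = length s + 1) :: nat)" for i
  have bump: "Poly_Mapping.lookup f (g i) = Poly_Mapping.lookup f (g (Suc i))"
    if i: "1 \<le> i" "i \<le> length s" for i
  proof -
    have "(\<Sum>e\<in>{e \<in> edges s. tail s e = int (length s) - int i}. Poly_Mapping.lookup f e) = Poly_Mapping.lookup f (g i)"
    proof (rule sum_eq_single)
      show "g i \<in> {e \<in> edges s. tail s e = int (length s) - int i}"
        using i by (auto simp: g_def edges_eq tail_def source_edges_def)
      fix x assume x: "x \<in> {e \<in> edges s. tail s e = int (length s) - int i}" "x \<noteq> g i"
      obtain a t where at: "x = (a, t)" by (cases x)
      then have "a = i" "1 \<le> t" "t \<le> part s a"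
        using tail_inner[of a t s "int (length s) - int i"] x i by (auto simp: g_def)
      then show "Poly_Mapping.lookup f x = 0" using z i at by simp
    qed (simp add: finite_edges)
    moreover have "(\<Sum>e\<in>{e \<in> edges s. head s e = int (length s) - int i}. Poly_Mapping.lookup f e) =
        Poly_Mapping.lookup f (g (Suc i))"
    proof (rule sum_eq_single)
      show "g (Suc i) \<in> {e \<in> edges s. head s e = int (length s) - int i}"
        using i by (auto simp: g_def edges_eq head_def)
      fix x assume x: "x \<in> {e \<in> edges s. head s e = int (length s) - int i}" "x \<noteq> g (Suc i)"
      obtain a t where at: "x = (a, t)" by (cases x)
      then have "a = Suc i" using x by (auto simp: head_def)
      then have "a \<le> length s" "1 \<le> t" "t \<le> part s a"
        using x at by (auto simp: edges_eq g_def split: if_splits)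
      then show "Poly_Mapping.lookup f x = 0" using z i at \<open>a = Suc i\<close> by simp
    qed (simp add: finite_edges)
    moreover have "netflow s f (int (length s) - int i) = 0" using n i by simp
    ultimately show ?thesis by (simp add: netflow_def)
  qed
  have all: "Poly_Mapping.lookup f (g i) = c" if "1 \<le> i" "i \<le> length s + 1" for i
    using that(2,1)
  proof (induction i rule: inc_induct)
    case base
    show ?case by (simp add: g_def c_def)
  next
    case (step k)
    then show ?case using bump[of k] by simp
  qed
  have "f = c *\<^sub>R route_vector (route s [])"
  proof (rule poly_mapping_eqI)
    fix x :: edge
    obtain a t where at: "x = (a, t)" by (cases x)
    have rN: "x \<in> set (route s []) \<longleftrightarrow> 1 \<le> a \<and> a \<le> length s + 1 \<and> x = g a"
      unfolding at route_Nil g_def by auto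
    show "Poly_Mapping.lookup f x = Poly_Mapping.lookup (c *\<^sub>R route_vector (route s [])) x"
    proof (cases "x \<in> set (route s [])")
      case True
      then show ?thesis using all rN by (simp add: lookup_route_vector)
    next
      case False
      have "Poly_Mapping.lookup f x = 0"
      proof (cases "x \<in> edges s")
        case True
        then have "1 \<le> a" "a \<le> length s" "1 \<le> t" "t \<le> part s a"
          using False unfolding rN unfolding at edges_eq g_def by (auto split: if_splits)
        then show ?thesis using z at by simp
      qed (simp add: e)
      then show ?thesis using False by (simp add: lookup_route_vector)
    qed
  qed
  then show ?thesis by (simp add: c_def)
qed

lemma route_take_in_routes: "stirling_perm s w \<Longrightarrow> route s (take i w) \<in> routes s"
  using route_in_routes[of s w "take i w" "drop i w"] by simp

lemma prefix_vector_in_flow_polytope: "stirling_perm s w \<Longrightarrow> prefix_vector s w i \<in> flow_polytope s"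
  unfolding prefix_vector_def by (intro route_vector_in_flow_polytope route_take_in_routes distinct_route)

text \<open>Subtracting multiples of the route vectors in reverse order clears the new edges one by one;
  what remains is supported on the bumps and \<open>e\<^sup>n\<^sup>+\<^sup>1\<^sub>1\<close>, hence a multiple of the first route.\<close>

lemma flow_decomposition:
  fixes f :: "edge \<Rightarrow>\<^sub>0 real"
  assumes w: "stirling_perm s w" and k: "k \<le> length w"
    and e: "\<And>e. e \<notin> edges s \<Longrightarrow> Poly_Mapping.lookup f e = 0"
    and n: "\<And>v. v \<in> {0..<int (length s)} \<Longrightarrow> netflow s f v = 0"
    and z: "\<And>j. k \<le> j \<Longrightarrow> j < length w \<Longrightarrow> Poly_Mapping.lookup f (new_edge w j) = 0"
  shows "\<exists>c. f = (\<Sum>i\<in>{0..k}. c i *\<^sub>R prefix_vector s w i)"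
  using k e n z
proof (induction k arbitrary: f)
  case 0
  have "Poly_Mapping.lookup f (a, t) = 0" if "1 \<le> a" "a \<le> length s" "1 \<le> t" "t \<le> part s a" for a t
  proof -
    have "count_list w a = part s a" using w that by (simp add: stirling_perm_def)
    then obtain j where "j < length w" "new_edge w j = (a, t)"
      using new_edge_surj[of t w a] \<open>1 \<le> t\<close> \<open>t \<le> part s a\<close> by auto
    then show ?thesis using 0(4)[of j] by simp
  qed
  then have "f = Poly_Mapping.lookup f (length s + 1, 1) *\<^sub>R route_vector (route s [])"
    using flow_on_bumps[of s f] 0 by blast
  then show ?case
    by (intro exI[of _ "\<lambda>_. Poly_Mapping.lookup f (length s + 1, 1)"]) (simp add: prefix_vector_def)
next
  case (Suc k)
  \<comment> \<open>The vector for \<open>Suc k\<close> is 1 at \<open>new_edge w k\<close> and 0 at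
    all later new edges, so subtracting it clears one edge and spoils none already cleared.\<close>
  define l where "l = Poly_Mapping.lookup f (new_edge w k)"
  define g where "g = f - l *\<^sub>R prefix_vector s w (Suc k)"
  note P = prefix_vector_in_flow_polytope[OF w, of "Suc k", unfolded flow_polytope_def]
  have lg: "Poly_Mapping.lookup g x =
      Poly_Mapping.lookup f x - l * Poly_Mapping.lookup (prefix_vector s w (Suc k)) x" for x
    by (simp add: g_def lookup_minus)
  have "\<exists>c. g = (\<Sum>i\<in>{0..k}. c i *\<^sub>R prefix_vector s w i)"
  proof (rule Suc.IH)
    show "k \<le> length w" using Suc.prems(1) by simp
    show "Poly_Mapping.lookup g x = 0" if "x \<notin> edges s" for x
      using P Suc.prems(2)[OF that] that by (auto simp: lg in_keys_iff)
    show "netflow s g v = 0" if "v \<in> {0..<int (length s)}" for v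
      using P Suc.prems(3)[OF that] that unfolding g_def
      by (simp add: linear_diff[OF linear_netflow] linear_scale[OF linear_netflow])
    show "Poly_Mapping.lookup g (new_edge w j) = 0" if j: "k \<le> j" "j < length w" for j
    proof (cases "j = k")
      case True
      then show ?thesis using lookup_prefix_vector_new[OF w, of k] j by (simp add: lg l_def)
    next
      case False
      then show ?thesis using lookup_prefix_vector_old[OF w, of j "Suc k"] Suc.prems(4)[of j] j by (simp add: lg)
    qed
  qed
  then obtain c where "g = (\<Sum>i\<in>{0..k}. c i *\<^sub>R prefix_vector s w i)" by blast
  then have "f = (\<Sum>i\<in>{0..k}. c i *\<^sub>R prefix_vector s w i) + l *\<^sub>R prefix_vector s w (Suc k)"
    by (simp add: g_def diff_eq_eq)
  then have "f = (\<Sum>i\<in>{0..Suc k}. (c(Suc k := l)) i *\<^sub>R prefix_vector s w i)"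
    by (simp add: atLeast0_atMost_Suc add.commute)
  then show ?case by blast
qed

lemma affine_hull_prefix_vectors:
  assumes w: "stirling_perm s w"
  shows "affine hull (prefix_vector s w ` {0..length w}) = affine hull (flow_polytope s)"
proof
  show "affine hull (prefix_vector s w ` {0..length w}) \<subseteq> affine hull (flow_polytope s)"
    using prefix_vector_in_flow_polytope[OF w] by (intro hull_mono) auto
  have "f \<in> affine hull (prefix_vector s w ` {0..length w})" if f: "f \<in> flow_polytope s" for f
  proof -
    note F = f[unfolded flow_polytope_def]
    have "\<exists>c. f = (\<Sum>i\<in>{0..length w}. c i *\<^sub>R prefix_vector s w i)"
      by (rule flow_decomposition[OF w]) (use F in \<open>auto simp: in_keys_iff\<close>)
    then obtain c where c: "f = (\<Sum>i\<in>{0..length w}. c i *\<^sub>R prefix_vector s w i)" by blast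
    \<comment> \<open>Every flow in the polytope has netflow 1 at the source, so the coefficients
      sum to 1 and the combination is affine.\<close>
    have "1 = netflow s f (- 1)" using F by simp
    also have "\<dots> = (\<Sum>i\<in>{0..length w}. c i * netflow s (prefix_vector s w i) (- 1))"
      unfolding c by (simp add: linear_sum[OF linear_netflow] linear_scale[OF linear_netflow])
    also have "\<dots> = (\<Sum>i\<in>{0..length w}. c i)"
      using prefix_vector_in_flow_polytope[OF w] by (simp add: flow_polytope_def)
    finally have c1: "(\<Sum>i\<in>{0..length w}. c i) = 1" by simp
    \<comment> \<open>Coefficients are carried over from indices to vectors, as
      \<open>affine_hull_finite\<close> requires.\<close>
    let ?i = "the_inv_into {0..length w} (prefix_vector s w)"
    have inv: "?i (prefix_vector s w i) = i" if "i \<in> {0..length w}" for i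
      using the_inv_into_f_f[OF inj_on_prefix_vector[OF w] that] .
    have "sum (c \<circ> ?i) (prefix_vector s w ` {0..length w}) = 1"
      using c1 inv by (simp add: sum.reindex[OF inj_on_prefix_vector[OF w]])
    moreover have "(\<Sum>v\<in>prefix_vector s w ` {0..length w}. (c \<circ> ?i) v *\<^sub>R v) = f"
      using inv by (simp add: sum.reindex[OF inj_on_prefix_vector[OF w]] c)
    ultimately show ?thesis by (subst affine_hull_finite) auto
  qed
  then show "affine hull (flow_polytope s) \<subseteq> affine hull (prefix_vector s w ` {0..length w})"
    by (intro hull_minimal) (auto simp: affine_affine_hull)
qed

section \<open>From simplices back to sets of routes\<close>

lemma prefix_routes_eq_image: "prefix_routes s w = (\<lambda>i. route s (take i w)) ` {0..length w}"
proof
  show "prefix_routes s w \<subseteq> (\<lambda>i. route s (take i w)) ` {0..length w}"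
  proof
    fix r assume "r \<in> prefix_routes s w"
    then obtain u v where "r = route s u" "w = u @ v" unfolding prefix_routes_def by blast
    then show "r \<in> (\<lambda>i. route s (take i w)) ` {0..length w}"
      by (intro image_eqI[of _ _ "length u"]) auto
  qed
  show "(\<lambda>i. route s (take i w)) ` {0..length w} \<subseteq> prefix_routes s w"
    unfolding prefix_routes_def using append_take_drop_id by (metis (mono_tags, lifting) image_subsetI mem_Collect_eq)
qed

lemma prefix_vectors_eq:
  "prefix_vector s w ` {0..length w} = route_vector ` prefix_routes s w"
  by (simp add: prefix_routes_eq_image prefix_vector_def image_image)

lemma Delta_eq:
  assumes "stirling_perm s w"
  shows "Delta s w = convex hull (route_vector ` prefix_routes s w)"
  unfolding Delta_def prefix_vectors_eq[symmetric] prefix_vector_def length_stirling_perm[OF assms] ..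

text \<open>A route vector sees only the set of edges; routes list their letters in decreasing
  order, so nothing is lost.\<close>

lemma route_determined_by_set:
  assumes "set (route s u) = set (route s v)"
  shows "route s u = route s v"
proof -
  have mem: "(a, k) \<in> set (route s u) \<longleftrightarrow> (a, k) \<in> set (route s v)" for a k using assms by simp
  have "route_start s u \<le> route_start s v" "route_start s v \<le> route_start s u"
    using mem[of "route_start s u"] mem[of "route_start s v"] route_start_bounds(1)
    by (auto simp: route_mem_iff)
  then have st: "route_start s u = route_start s v" by simp
  have "count_list u a = count_list v a" if "a \<noteq> length s + 1" "1 \<le> a" "a \<le> route_start s v" for a
    using mem[of a "count_list u a"] that st by (auto simp: route_mem_iff)
  then show ?thesis unfolding route_def st by auto
qed

lemma inj_on_route_vector: "inj_on route_vector (range (route s))"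
proof (rule inj_onI)
  fix p q assume p: "p \<in> range (route s)" "q \<in> range (route s)" "route_vector p = route_vector q"
  have "e \<in> set p \<longleftrightarrow> e \<in> set q" for e
    using lookup_route_vector[of p e] lookup_route_vector[of q e] p(3) by (auto split: if_splits)
  then show "p = q" using p route_determined_by_set by blast
qed

text \<open>Of two prefixes of one word, one extends the other, so their counts are
  comparable.\<close>

lemma pairwise_coherent_prefix_routes:
  assumes s: "composition s"
  shows "pairwise (coherent s) (prefix_routes s w)"
proof (rule pairwiseI)
  fix p q assume "p \<in> prefix_routes s w" "q \<in> prefix_routes s w"
  then obtain u v u' v' where h: "p = route s u" "q = route s u'" "u @ v = u' @ v'"
    unfolding prefix_routes_def by auto
  then have "(\<exists>t. u' = u @ t) \<or> (\<exists>t. u = u' @ t)" by (auto simp: append_eq_append_conv2)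
  then show "coherent s p q" unfolding h(1,2) using coherent_routes[OF s] by auto
qed

theorem theorem3p10:
  fixes s w w' :: "nat list"
  assumes "composition s" and "stirling_perm s w" and "stirling_perm s w'"
  shows "(covered_by s w w' \<or> covered_by s w' w) \<longleftrightarrow>
         adjacent_in (flow_polytope s) (dkk_triangulation s) (Delta s w) (Delta s w')"
proof -
  let ?V = "\<lambda>w. route_vector ` prefix_routes s w"
  have fin: "finite (?V w)" for w by (simp add: prefix_routes_eq_image)
  have ind: "\<not> affine_dependent (?V w)" if "stirling_perm s w" for w
    using independent_prefix_vectors[OF that, of "length w"] affine_dependent_imp_dependent
    by (auto simp: prefix_vectors_eq)
  have tri: "Delta s w \<in> dkk_triangulation s" if w: "stirling_perm s w" for w
  proof -
    have "prefix_routes s w \<noteq> {}" by (simp add: prefix_routes_eq_image)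
    moreover have "prefix_routes s w \<subseteq> routes s"
      using route_take_in_routes[OF w] by (auto simp: prefix_routes_eq_image)
    ultimately show ?thesis
      using pairwise_coherent_prefix_routes[OF assms(1)] unfolding dkk_triangulation_def Delta_eq[OF w] by blast
  qed
  have aff: "affine hull Delta s w = affine hull flow_polytope s" if w: "stirling_perm s w" for w
    using affine_hull_prefix_vectors[OF w] by (simp add: Delta_eq[OF w] prefix_vectors_eq)
  have sub: "prefix_routes s w \<subseteq> range (route s)" for w unfolding prefix_routes_def by blast
  have V_Diff: "route_vector ` (prefix_routes s w - {r}) = ?V w - {route_vector r}"
    if "r \<in> prefix_routes s w" for r w
    using inj_on_image_set_diff[OF inj_on_route_vector[of s], of "prefix_routes s w" "{r}"] that sub[of w] by auto
  \<comment> \<open>Injectivity of \<open>route_vector\<close> on these routes turns the facet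
    condition on vertices into one on routes.\<close>
  have V_eq: "?V w - {route_vector r} = ?V w' - {route_vector r'} \<longleftrightarrow>
      prefix_routes s w - {r} = prefix_routes s w' - {r'}"
    if "r \<in> prefix_routes s w" "r' \<in> prefix_routes s w'" for r r'
    unfolding V_Diff[OF that(1), symmetric] V_Diff[OF that(2), symmetric]
    by (rule inj_on_image_eq_iff[OF inj_on_route_vector[of s]]) (use sub in auto)
  have "Delta s w = Delta s w' \<longleftrightarrow> w = w'"
  proof
    assume "Delta s w = Delta s w'"
    then have "convex hull ?V w = convex hull ?V w'" by (simp only: Delta_eq assms)
    then have "?V w = ?V w'"
      by (rule convex_hull_vertices_eq[OF fin ind[OF assms(2)] fin ind[OF assms(3)]])
    then have "prefix_routes s w = prefix_routes s w'"
      using inj_on_image_eq_iff[OF inj_on_route_vector[of s] sub sub] by simp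
    then show "w = w'" using prefix_routes_inj[OF assms(2,3)] by simp
  qed simp
  moreover have "(\<exists>F. simplex_facet F (Delta s w) \<and> simplex_facet F (Delta s w')) \<longleftrightarrow>
      (\<exists>a\<in>?V w. \<exists>b\<in>?V w'. ?V w - {a} = ?V w' - {b})"
    unfolding Delta_eq[OF assms(2)] Delta_eq[OF assms(3)]
    by (rule common_simplex_facet_iff[OF fin ind[OF assms(2)] fin ind[OF assms(3)]])
  then have "(\<exists>F. simplex_facet F (Delta s w) \<and> simplex_facet F (Delta s w')) \<longleftrightarrow>
      (\<exists>r\<in>prefix_routes s w. \<exists>r'\<in>prefix_routes s w'. prefix_routes s w - {r} = prefix_routes s w' - {r'})"
    using V_eq by simp
  ultimately show ?thesis
    using ascent_move_iff_prefix_routes[OF assms(2,3)] covered_by_iff_ascent_move[OF assms(2,3)]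
      covered_by_iff_ascent_move[OF assms(3,2)] tri assms aff
    unfolding adjacent_in_def by simp
qed

end
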